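(* Let $\nu>0$. Then $\mathcal{G}^\nu=\mathcal{B}^{2,\nu}\circ\mathcal{B}^{1,\nu}$ on $L^{2,\nu}(\mathbb{R},\mathbb{C})$. That is, for every $f\in L^{2,\nu}(\mathbb{R},\mathbb{C})$ and all $(z,w)\in\mathbb{C}^2$, $\mathcal{B}^{2,\nu}(\mathcal{B}^{1,\nu}f)(z,w)=\mathcal{G}^\nu f(z,w)$. Moreover, $\mathcal{G}^\nu$ defines an isometric operator mapping the Hilbert space $L^{2,\nu}(\mathbb{R},\mathbb{C})$ into the Bargmann-Fock space $\mathcal{F}^{2,\nu}(\mathbb{C}^2)$.
   Context: Let $\nu>0$. $L^{2,\nu}(\mathbb{R}^d,\mathbb{C})$ is the Hilbert space of $\mathbb{C}$-valued functions on $\mathbb{R}^d$ that are square integrable with respect to $e^{-\nu|x|^2}dx$. $L^{2,\nu}(\mathbb{C}^d,\mathbb{C})$ is the Hilbert space of $\mathbb{C}$-valued functions on $\mathbb{C}^d$ that are square integrable with respect to $e^{-\nu|z|^2}d\lambda$, with $d\lambda$ the Lebesgue measure. The Bargmann-Fock space is $\mathcal{F}^{2,\nu}(\mathbb{C}^d)=Hol(\mathbb{C}^d)\cap L^{2,\nu}(\mathbb{C}^d,\mathbb{C})$, with the scalar product and norm of $L^{2,\nu}(\mathbb{C}^d,\mathbb{C})$. The $d$-dimensional Segal-Bargmann transform is $$\mathcal{B}^{d,\nu}f(z)=\left(\frac{\nu}{\pi}\right)^{\frac{3d}{4}}\int_{\mathbb{R}^d}f(x)\,e^{-\nu\left(x-\frac{z}{\sqrt2}\right)^2}dx,\qquad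 z\in\mathbb{C}^d,$$ where $u^2:=u_1^2+\cdots+u_d^2$ for $u\in\mathbb{C}^d$. It is a unitary isomorphism from $L^{2,\nu}(\mathbb{R}^d,\mathbb{C})$ onto $\mathcal{F}^{2,\nu}(\mathbb{C}^d)$. In the composition $\mathcal{B}^{2,\nu}\circ\mathcal{B}^{1,\nu}$, the space $\mathcal{F}^{2,\nu}(\mathbb{C})\subset L^{2,\nu}(\mathbb{C},\mathbb{C})$ is regarded as a subspace of $L^{2,\nu}(\mathbb{R}^2,\mathbb{C})$ through the identification $x+iy\leftrightarrow(x,y)$. The transform $\mathcal{G}^\nu$ is defined on $L^{2,\nu}(\mathbb{R},\mathbb{C})$ by $$\mathcal{G}^\nu f(z,w)=\left(\frac{\nu}{\pi}\right)^{\frac12}(\mathcal{B}^{1,\nu}f)\left(\frac{z+iw}{\sqrt2}\right),\qquad (z,w)\in\mathbb{C}^2.$$ *)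

theory Defs
  imports "HOL-Analysis.Analysis"
begin

definition gauss_measure :: "real \<Rightarrow> 'a::euclidean_space measure" where
  "gauss_measure \<nu> = density lebesgue (\<lambda>x. ennreal (exp (- \<nu> * (norm x)\<^sup>2)))"

text \<open>
  Elements of the L2 spaces are represented by functions; two of them stand for the same
  vector of the Hilbert space iff they agree almost everywhere. The definitions apply to
  real and to \<open>real^'d\<close>, and to complex and \<open>complex^'d\<close> as real Euclidean spaces
  (of real dimension 2 and 2d).
\<close>

definition gauss_L2 :: "real \<Rightarrow> ('a::euclidean_space \<Rightarrow> complex) set" where
  "gauss_L2 \<nu> = {f. f \<in> borel_measurable (gauss_measure \<nu>) \<and>
                     integrable (gauss_measure \<nu>) (\<lambda>x. (cmod (f x))\<^sup>2)}"

definition gauss_inner ::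
    "real \<Rightarrow> ('a::euclidean_space \<Rightarrow> complex) \<Rightarrow> ('a \<Rightarrow> complex) \<Rightarrow> complex" where
  "gauss_inner \<nu> f g = (\<integral>x. f x * cnj (g x) \<partial>gauss_measure \<nu>)"

definition gauss_norm :: "real \<Rightarrow> ('a::euclidean_space \<Rightarrow> complex) \<Rightarrow> real" where
  "gauss_norm \<nu> f = sqrt (Re (gauss_inner \<nu> f f))"

text \<open>Entire functions of several complex variables: the (real) Frechet derivative exists
  at every point and is complex linear.\<close>

definition entire_fun :: "(complex ^ 'd \<Rightarrow> complex) \<Rightarrow> bool" where
  "entire_fun F \<longleftrightarrow>
     (\<forall>z. \<exists>D. (F has_derivative D) (at z) \<and> (\<forall>c v. D (c *s v) = c * D v))"

definition Fock :: "real \<Rightarrow> (complex ^ 'd \<Rightarrow> complex) set" where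
  "Fock \<nu> = {F. entire_fun F} \<inter> gauss_L2 \<nu>"

text \<open>The bilinear (not Hermitian) square.\<close>

definition csquare :: "complex ^ 'd \<Rightarrow> complex" where
  "csquare u = (\<Sum>i\<in>UNIV. (u $ i)\<^sup>2)"

definition Bargmann ::
    "real \<Rightarrow> (real ^ 'd \<Rightarrow> complex) \<Rightarrow> complex ^ 'd \<Rightarrow> complex" where
  "Bargmann \<nu> f z =
     complex_of_real ((\<nu> / pi) powr (3 * real CARD('d) / 4)) *
     (\<integral>x. f x * exp (- complex_of_real \<nu> *
              csquare (\<chi> i. complex_of_real (x $ i) - z $ i / complex_of_real (sqrt 2)))
        \<partial>lebesgue)"

text \<open>The case d = 1, with \<open>real^1\<close> and \<open>complex^1\<close> identified with real and complex.\<close>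

definition Bargmann1 :: "real \<Rightarrow> (real \<Rightarrow> complex) \<Rightarrow> complex \<Rightarrow> complex" where
  "Bargmann1 \<nu> f z = Bargmann \<nu> (\<lambda>x :: real ^ 1. f (x $ 1)) (\<chi> i. z)"

definition on_plane :: "(complex \<Rightarrow> complex) \<Rightarrow> real ^ 2 \<Rightarrow> complex" where
  "on_plane g p = g (Complex (p $ 1) (p $ 2))"

definition G_transform :: "real \<Rightarrow> (real \<Rightarrow> complex) \<Rightarrow> complex ^ 2 \<Rightarrow> complex" where
  "G_transform \<nu> f v =
     complex_of_real ((\<nu> / pi) powr (1 / 2)) *
     Bargmann1 \<nu> f ((v $ 1 + \<i> * v $ 2) / complex_of_real (sqrt 2))"

text \<open>
  Isometric linear operator from the Gaussian L2 space into a space \<open>H\<close> of functions normed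
  as a Gaussian L2 space. The second clause makes the operator well defined on almost
  everywhere classes. Equalities of values are pointwise, since the intended \<open>H\<close>, the
  Bargmann-Fock space, consists of genuine (continuous) functions.
\<close>

definition isometric_operator ::
    "real \<Rightarrow> (('a::euclidean_space \<Rightarrow> complex) \<Rightarrow> 'b::euclidean_space \<Rightarrow> complex) \<Rightarrow>
     ('b \<Rightarrow> complex) set \<Rightarrow> bool" where
  "isometric_operator \<nu> T H \<longleftrightarrow>
     (\<forall>f\<in>gauss_L2 \<nu>. T f \<in> H) \<and>
     (\<forall>f\<in>gauss_L2 \<nu>. \<forall>g\<in>gauss_L2 \<nu>. (AE x in gauss_measure \<nu>. f x = g x) \<longrightarrow> T f = T g) \<and>
     (\<forall>f\<in>gauss_L2 \<nu>. \<forall>g\<in>gauss_L2 \<nu>. T (\<lambda>x. f x + g x) = (\<lambda>z. T f z + T g z)) \<and>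
     (\<forall>c. \<forall>f\<in>gauss_L2 \<nu>. T (\<lambda>x. c * f x) = (\<lambda>z. c * T f z)) \<and>
     (\<forall>f\<in>gauss_L2 \<nu>. gauss_norm \<nu> (T f) = gauss_norm \<nu> f)"

end

theory Submission
  imports Defs "HOL-Probability.Characteristic_Functions"
begin

text \<open>
  Expanding the squares, the composition of the two Segal-Bargmann transforms applied to \<open>f\<close> becomes,
  by Fubini, the integral of \<open>f\<close> against a two-dimensional complex Gaussian integral, which evaluates
  to the kernel of the one-dimensional transform at \<open>(z + \<i>w) / \<surd>2\<close>.

  For the isometry, put \<open>h\<^sub>x(t) = f(t) exp(- \<nu> t\<^sup>2 + \<surd>2 \<nu> x t)\<close>. Up to a
  factor of modulus \<open>exp(- \<nu> (x\<^sup>2 - y\<^sup>2) / 2)\<close> and a constant, the one-dimensional transform at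
  \<open>x + \<i>y\<close> is the Fourier transform of \<open>h\<^sub>x\<close> at \<open>\<surd>2 \<nu> y\<close>. Plancherel's theorem
  in \<open>y\<close> followed by a Gaussian integration in \<open>x\<close> gives the norm of \<open>f\<close>. The passage from one
  to two complex variables is the unitary change of variables with first coordinate
  \<open>(z + \<i>w) / \<surd>2\<close>; the second coordinate contributes the factor \<open>\<pi> / \<nu>\<close>.
\<close>

subsection \<open>Lebesgue measure in coordinates\<close>

text \<open>Two points shape the argument. A vector of the Hilbert space is a Lebesgue measurable
  function up to null sets, whereas Fubini is applied in coordinates; so everything is proved for a
  Borel representative, and the transform is shown to depend only on the class, at every point. The
  norm identities are stated for nonnegative extended integrals: exchanging them takes measurability
  alone, and finiteness of the norm of the image comes out together with its value. Plancherel is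
  reached by damping the Fourier transform with exp(-a y^2). Fubini turns the damped norm into a
  Gaussian average of the autocorrelation, and continuity of translations removes the damping. It
  applies without a weight in y because the y-part of exp(-\<nu>|z|^2) cancels against |exp(-\<nu>
  z^2/2)|^2. The factor (\<nu>/\<pi>)^(1/2) of \<open>G_transform\<close> is the two-dimensional
  normalisation (\<nu>/\<pi>)^(3/2) times the constant \<pi>/\<nu> of the plane Gaussian integral;
  its square cancels the \<pi>/\<nu> left by the second rotated coordinate.\<close>

text \<open>A map that only relabels coordinates pulls boxes back to boxes with the same edge
  lengths, and boxes determine the measure. This covers all the identifications below: pairs with
  \<open>vector\<close>, pairs with \<open>Complex\<close>, and \<open>real ^ 1\<close> with
  \<open>real\<close>.\<close>

lemma lborel_distr_Basis_bij:
  fixes f :: "'a::euclidean_space \<Rightarrow> 'b::euclidean_space"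
  assumes h: "bij_betw h (Basis :: 'b set) (Basis :: 'a set)"
    and f: "\<And>x b. b \<in> Basis \<Longrightarrow> f x \<bullet> b = x \<bullet> h b"
  shows "distr lborel borel f = lborel"
proof (rule lborel_eqI[symmetric])
  have "f = (\<lambda>x. \<Sum>b\<in>Basis. (x \<bullet> h b) *\<^sub>R b)"
    by (rule ext, rule euclidean_eqI) (simp add: f inner_sum_left_Basis)
  then have meas [measurable]: "f \<in> borel_measurable borel"
    by (elim ssubst) (intro borel_measurable_continuous_onI continuous_intros)
  fix l u :: 'b
  assume lu: "\<And>b. b \<in> Basis \<Longrightarrow> l \<bullet> b \<le> u \<bullet> b"
  define g :: "'b \<Rightarrow> 'a" where "g y = (\<Sum>b\<in>Basis. (y \<bullet> b) *\<^sub>R h b)" for y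
  have hB: "h b \<in> Basis" if "b \<in> Basis" for b
    using h that by (auto simp: bij_betw_def)
  have surj: "\<exists>b\<in>Basis. c = h b" if "c \<in> Basis" for c
    using h that by (auto simp: bij_betw_def)
  have inj: "h b = h c \<longleftrightarrow> b = c" if "b \<in> Basis" "c \<in> Basis" for b c
    using h that by (auto simp: bij_betw_def inj_on_def)
  have g: "g y \<bullet> h b = y \<bullet> b" if b: "b \<in> Basis" for y b
  proof -
    have "g y \<bullet> h b = (\<Sum>c\<in>Basis. if c = b then y \<bullet> c else 0)"
      unfolding g_def inner_sum_left
      by (rule sum.cong) (auto simp: inner_Basis hB b inj)
    then show ?thesis using b by simp
  qed
  have "f -` box l u = box (g l) (g u)"
  proof (rule set_eqI)
    fix x
    have "x \<in> f -` box l u \<longleftrightarrow> (\<forall>b\<in>Basis. g l \<bullet> h b < x \<bullet> h b \<and> x \<bullet> h b < g u \<bullet> h b)"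
      by (auto simp: mem_box f g)
    also have "\<dots> \<longleftrightarrow> x \<in> box (g l) (g u)"
      unfolding mem_box using hB surj by metis
    finally show "x \<in> f -` box l u \<longleftrightarrow> x \<in> box (g l) (g u)" .
  qed
  then have "emeasure (distr lborel borel f) (box l u) = emeasure lborel (box (g l) (g u))"
    by (simp add: emeasure_distr)
  also have "\<dots> = (\<Prod>c\<in>Basis. (g u - g l) \<bullet> c)"
  proof (rule emeasure_lborel_box)
    fix c :: 'a
    assume "c \<in> Basis"
    then obtain b where "b \<in> Basis" "c = h b"
      using surj by blast
    then show "g l \<bullet> c \<le> g u \<bullet> c"
      using lu by (simp add: g)
  qed
  also have "(\<Prod>c\<in>Basis. (g u - g l) \<bullet> c) = (\<Prod>b\<in>Basis. (g u - g l) \<bullet> h b)"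
    by (rule prod.reindex_bij_betw[symmetric, OF h])
  also have "\<dots> = (\<Prod>b\<in>Basis. (u - l) \<bullet> b)"
    by (rule prod.cong) (simp_all add: g inner_diff_left)
  finally show "emeasure (distr lborel borel f) (box l u) = (\<Prod>b\<in>Basis. (u - l) \<bullet> b)" .
qed simp

lemma lborel_distr_vector2:
  "distr lborel borel (\<lambda>(z, w). vector [z, w] :: 'a::euclidean_space ^ 2) = lborel"
proof (rule lborel_distr_Basis_bij
    [where h = "\<lambda>b. (if b $ 1 = 0 then (0, b $ 2) else (b $ 1, 0))"])
  \<comment> \<open>A basis vector of \<open>'a ^ 2\<close> has exactly one nonzero component, so
    the test \<open>b $ 1 = 0\<close> separates the two families.\<close>
  let ?h = "\<lambda>b :: 'a ^ 2. (if b $ 1 = 0 then (0, b $ 2) else (b $ 1, 0))"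
  have B: "(Basis :: ('a ^ 2) set) = axis 1 ` Basis \<union> axis 2 ` Basis"
    unfolding Basis_vec_def UNIV_2 by auto
  have *: "?h (axis 1 b) = (b, 0)" "?h (axis 2 b) = (0, b)" if "b \<in> Basis" for b
    using that by (auto simp: axis_def)
  show "bij_betw ?h Basis Basis"
    unfolding bij_betw_def
  proof
    show "inj_on ?h Basis"
      unfolding B inj_on_def by (auto simp: axis_def)
    show "?h ` Basis = Basis"
      unfolding B image_Un image_image Basis_prod_def using *
      by (auto simp: image_def)
  qed
  show "(case x of (z, w) \<Rightarrow> (vector [z, w] :: 'a ^ 2)) \<bullet> b = x \<bullet> ?h b" if "b \<in> Basis" for x b
    using that unfolding B
    by (cases x) (auto simp: inner_axis, auto simp: axis_def)
qed

lemma lborel_distr_Complex: "distr lborel borel (\<lambda>(x, y). Complex x y) = lborel"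
proof (rule lborel_distr_Basis_bij[where h = "\<lambda>b. (Re b, Im b)"])
  have *: "(Basis :: (real \<times> real) set) = {(1, 0), (0, 1)}"
    by (auto simp: Basis_prod_def)
  show "bij_betw (\<lambda>b. (Re b, Im b)) Basis Basis"
    unfolding * bij_betw_def Basis_complex_def by simp
  show "(case p of (x, y) \<Rightarrow> Complex x y) \<bullet> b = p \<bullet> (Re b, Im b)" for p b
    by (cases p) (simp add: inner_complex_def)
qed

lemma measurable_Complex [measurable]: "(\<lambda>(x, y). Complex x y) \<in> borel_measurable borel"
proof -
  have "(\<lambda>(x, y). Complex x y) = (\<lambda>p. of_real (fst p) + \<i> * of_real (snd p))"
    by (auto simp: complex_eq_iff)
  then show ?thesis
    by (elim ssubst) (intro borel_measurable_continuous_onI continuous_intros)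
qed

lemma measurable_vector2 [measurable]:
  "(\<lambda>(z, w). vector [z, w] :: 'a::euclidean_space ^ 2) \<in> borel_measurable borel"
proof (intro borel_measurable_continuous_onI)
  have comp: "continuous_on UNIV (\<lambda>p. (vector [fst p, snd p] :: 'a ^ 2) $ i)" for i
  proof -
    have "(\<lambda>p. (vector [fst p, snd p] :: 'a ^ 2) $ i) = fst
        \<or> (\<lambda>p. (vector [fst p, snd p] :: 'a ^ 2) $ i) = snd"
      using exhaust_2[of i] by auto
    then show ?thesis
    proof
      assume "(\<lambda>p. (vector [fst p, snd p] :: 'a ^ 2) $ i) = fst"
      then show ?thesis by (simp only: continuous_on_fst[OF continuous_on_id])
    next
      assume "(\<lambda>p. (vector [fst p, snd p] :: 'a ^ 2) $ i) = snd"
      then show ?thesis by (simp only: continuous_on_snd[OF continuous_on_id])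
    qed
  qed
  have "(\<lambda>(z, w). vector [z, w] :: 'a ^ 2) = (\<lambda>p. \<chi> i. (vector [fst p, snd p] :: 'a ^ 2) $ i)"
    by (auto simp: vec_eq_iff)
  then show "continuous_on UNIV (\<lambda>(z, w). vector [z, w] :: 'a ^ 2)"
    by (elim ssubst) (rule continuous_on_vec_lambda, rule comp)
qed

lemma lborel_distr_component1: "distr lborel borel (\<lambda>x :: real ^ 1. x $ 1) = lborel"
proof (rule lborel_distr_Basis_bij[where h = "\<lambda>_. axis 1 1"])
  have *: "(Basis :: (real ^ 1) set) = {axis 1 1}"
    by (auto simp: Basis_vec_def)
  show "bij_betw (\<lambda>_. axis 1 1) (Basis :: real set) (Basis :: (real ^ 1) set)"
    unfolding * by (simp add: bij_betw_def)
qed (simp add: inner_axis)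

lemma measurable_component [measurable]:
  "(\<lambda>x :: 'a::euclidean_space ^ 'n. x $ i) \<in> borel_measurable borel"
  by (intro borel_measurable_continuous_onI continuous_intros)

section \<open>Integrals over \<open>real ^ 2\<close>, \<open>complex\<close> and
  \<open>complex ^ 2\<close> in coordinates\<close>

lemma lebesgue_integral_vector2:
  fixes k :: "real ^ 2 \<Rightarrow> complex"
  assumes [measurable]: "k \<in> borel_measurable borel"
  shows "(\<integral>p. k p \<partial>lebesgue) = (\<integral>(x, y). k (vector [x, y]) \<partial>(lborel \<Otimes>\<^sub>M lborel))"
proof -
  have m: "(\<lambda>(x, y). vector [x, y] :: real ^ 2) \<in> lborel \<rightarrow>\<^sub>M borel"
    by simp
  have split: "k (case p of (x, y) \<Rightarrow> vector [x, y]) = (case p of (x, y) \<Rightarrow> k (vector [x, y]))" for p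
    by (cases p) simp
  have "(\<integral>p. k p \<partial>lebesgue) = (\<integral>p. k p \<partial>lborel)"
    by (rule integral_completion) measurable
  also have "\<dots> = (\<integral>p. k p \<partial>distr lborel borel (\<lambda>(x, y). vector [x, y]))"
    unfolding lborel_distr_vector2 by (rule refl)
  also have "\<dots> = (\<integral>p. k (case p of (x, y) \<Rightarrow> vector [x, y]) \<partial>lborel)"
    by (rule integral_distr[OF m]) measurable
  finally show ?thesis
    by (simp only: lborel_prod split)
qed

lemma nn_integral_Complex:
  assumes [measurable]: "\<phi> \<in> borel_measurable borel"
  shows "(\<integral>\<^sup>+z. \<phi> z \<partial>lborel) = (\<integral>\<^sup>+x. \<integral>\<^sup>+y. \<phi> (Complex x y) \<partial>lborel \<partial>lborel)"
proof -
  have m [measurable]: "(\<lambda>(x, y). Complex x y) \<in> lborel \<Otimes>\<^sub>M lborel \<rightarrow>\<^sub>M borel"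
    unfolding lborel_prod by simp
  have "(\<integral>\<^sup>+z. \<phi> z \<partial>lborel) = (\<integral>\<^sup>+z. \<phi> z \<partial>distr (lborel \<Otimes>\<^sub>M lborel) borel (\<lambda>(x, y). Complex x y))"
    unfolding lborel_prod lborel_distr_Complex by (rule refl)
  also have "\<dots> = (\<integral>\<^sup>+p. \<phi> (case p of (x, y) \<Rightarrow> Complex x y) \<partial>(lborel \<Otimes>\<^sub>M lborel))"
    by (rule nn_integral_distr) measurable
  also have "\<dots> = (\<integral>\<^sup>+x. \<integral>\<^sup>+y. \<phi> (Complex x y) \<partial>lborel \<partial>lborel)"
    by (subst lborel.nn_integral_fst[symmetric]) simp_all
  finally show ?thesis .
qed

text \<open>The first coordinate is the inner one, since the later rotation starts by substituting
  for \<open>z\<close> with \<open>w\<close> fixed.\<close>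

lemma nn_integral_vector2:
  fixes \<phi> :: "complex ^ 2 \<Rightarrow> ennreal"
  assumes [measurable]: "\<phi> \<in> borel_measurable borel"
  shows "(\<integral>\<^sup>+v. \<phi> v \<partial>lborel) = (\<integral>\<^sup>+w. \<integral>\<^sup>+z. \<phi> (vector [z, w]) \<partial>lborel \<partial>lborel)"
proof -
  have m [measurable]: "(\<lambda>(z, w). vector [z, w] :: complex ^ 2) \<in> lborel \<Otimes>\<^sub>M lborel \<rightarrow>\<^sub>M borel"
    unfolding lborel_prod by simp
  have "(\<integral>\<^sup>+v. \<phi> v \<partial>lborel) = (\<integral>\<^sup>+v. \<phi> v \<partial>distr (lborel \<Otimes>\<^sub>M lborel) borel (\<lambda>(z, w). vector [z, w]))"
    unfolding lborel_prod lborel_distr_vector2 by (rule refl)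
  also have "\<dots> = (\<integral>\<^sup>+p. \<phi> (case p of (z, w) \<Rightarrow> vector [z, w]) \<partial>(lborel \<Otimes>\<^sub>M lborel))"
    by (rule nn_integral_distr) measurable
  also have "\<dots> = (\<integral>\<^sup>+w. \<integral>\<^sup>+z. \<phi> (vector [z, w]) \<partial>lborel \<partial>lborel)"
    by (subst lborel_pair.nn_integral_snd[symmetric]) simp_all
  finally show ?thesis .
qed

text \<open>The factor 2 is the Jacobian of scaling by \<open>sqrt 2\<close> in real dimension 2.
  The rotation of two complex variables is later split into two such substitutions.\<close>

lemma nn_integral_complex_affine:
  fixes t :: complex
  assumes [measurable]: "\<phi> \<in> borel_measurable borel"
  shows "(\<integral>\<^sup>+z. \<phi> z \<partial>lborel) = 2 * (\<integral>\<^sup>+z. \<phi> (t + of_real (sqrt 2) * z) \<partial>lborel)"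
proof -
  have "(\<integral>\<^sup>+z. \<phi> z \<partial>lborel) =
      (\<integral>\<^sup>+z. \<phi> z \<partial>density (distr lborel borel (\<lambda>z. t + sqrt 2 *\<^sub>R z)) (\<lambda>_. ennreal (\<bar>sqrt 2\<bar> ^ DIM(complex))))"
    by (subst lborel_affine[of "sqrt 2" t]) simp_all
  also have "\<dots> = 2 * (\<integral>\<^sup>+z. \<phi> (t + of_real (sqrt 2) * z) \<partial>lborel)"
    by (simp add: nn_integral_density nn_integral_distr nn_integral_cmult scaleR_conv_of_real)
  finally show ?thesis .
qed

subsection \<open>Gaussian integrals\<close>

text \<open>The real part of \<open>b\<close> is absorbed by a real translation; the imaginary part
  leaves the characteristic function of the standard normal law. No contour has to be moved.\<close>

lemma has_bochner_integral_complex_gaussian: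
  fixes a :: real and b :: complex
  assumes a: "a > 0"
  shows "has_bochner_integral lborel (\<lambda>x. exp (- (of_real a * (of_real x)\<^sup>2) + b * of_real x))
           (of_real (sqrt (pi / a)) * exp (b\<^sup>2 / (4 * of_real a)))"
proof -
  have std: "has_bochner_integral lborel (\<lambda>v. exp (\<i> * (t * v) - v\<^sup>2 / 2)) (sqrt (2 * pi) * exp (- t\<^sup>2 / 2))"
    (is "has_bochner_integral _ ?f _") for t :: real
  proof -
    have "?f v = iexp (t * v) * exp (complex_of_real (- v\<^sup>2 / 2))" for v
      unfolding exp_add[symmetric] by simp
    then have eq: "std_normal_density v *\<^sub>R iexp (t * v) = ?f v / sqrt (2 * pi)" for v
      unfolding exp_of_real by (simp add: std_normal_density_def scaleR_conv_of_real)
    have "integrable std_normal_distribution (\<lambda>v. iexp (t * v))"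
      by (rule finite_measure.integrable_const_bound[where B = 1])
        (auto intro!: prob_space.finite_measure prob_space_normal_density simp: norm_exp_i_times)
    then have "has_bochner_integral lborel (\<lambda>v. std_normal_density v *\<^sub>R iexp (t * v)) (exp (- t\<^sup>2 / 2))"
      using fun_cong[OF char_std_normal_distribution, of t]
      by (subst has_bochner_integral_iff)
        (simp add: char_def integral_density integrable_density)
    note * = this[unfolded eq]
    have "has_bochner_integral lborel (\<lambda>v. complex_of_real (sqrt (2 * pi)) * (?f v / of_real (sqrt (2 * pi))))
        (of_real (sqrt (2 * pi)) * of_real (exp (- t\<^sup>2 / 2)))"
      by (rule has_bochner_integral_mult_right, rule *)
    then show ?thesis by simp
  qed
  \<comment> \<open>\<open>s\<close> is the centre of the real Gaussian, obtained by completing the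
    square with \<open>Re b\<close>; \<open>k\<close> scales it to variance 1, which is the identity
    \<open>a * k\<^sup>2 = 1 / 2\<close>.\<close>
  define s k where "s = Re b / (2 * a)" and "k = 1 / sqrt (2 * a)"
  have k: "k > 0" "k\<^sup>2 = 1 / (2 * a)"
    using a by (auto simp: k_def power_divide)
  \<comment> \<open>\<open>C\<close> is the exponent at the centre \<open>s\<close>, the part free
    of the new variable \<open>v\<close>.\<close>
  define C :: complex where "C = of_real (- (a * s\<^sup>2)) + b * of_real s"
  have b_eq: "b = of_real (a * (2 * s)) + \<i> * of_real (Im b)" and ak: "a * k\<^sup>2 = 1 / 2"
    using a by (simp_all add: s_def k flip: complex_eq)
  have *: "exp (- (of_real a * (complex_of_real (s + k * v))\<^sup>2) + b * of_real (s + k * v)) =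
      exp C * exp (\<i> * of_real ((Im b * k) * v) - of_real (v\<^sup>2 / 2))" for v
  proof -
    have "- (of_real a * (complex_of_real (s + k * v))\<^sup>2) + b * of_real (s + k * v) =
       C + (\<i> * of_real ((Im b * k) * v) - of_real ((a * k\<^sup>2) * v\<^sup>2))"
      unfolding C_def by (subst (1 2) b_eq) (simp add: algebra_simps power2_eq_square)
    then show ?thesis unfolding exp_add[symmetric] ak by simp
  qed
  have shifted: "has_bochner_integral lborel
      (\<lambda>v. exp (- (of_real a * (complex_of_real (s + k * v))\<^sup>2) + b * of_real (s + k * v)))
      (exp C * of_real (sqrt (2 * pi) * exp (- (Im b * k)\<^sup>2 / 2)))"
    unfolding * by (rule has_bochner_integral_mult_right, rule std)
  have val: "exp C * of_real (sqrt (2 * pi) * exp (- (Im b * k)\<^sup>2 / 2)) =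
      (of_real (sqrt (pi / a)) * exp (b\<^sup>2 / (4 * of_real a))) /\<^sub>R \<bar>k\<bar>"
  proof -
    have "C + of_real (- (Im b * k)\<^sup>2 / 2) = b\<^sup>2 / (4 * of_real a)"
    proof -
      have "4 * of_real a * (C + of_real (- (Im b * k)\<^sup>2 / 2)) = b\<^sup>2"
      proof -
        have "4 * of_real a * (C + of_real (- (Im b * k)\<^sup>2 / 2)) =
            4 * of_real a * C - 2 * of_real ((a * k\<^sup>2) * (Im b)\<^sup>2)"
          by (simp add: algebra_simps power2_eq_square)
        also have "\<dots> = 4 * of_real a * C - (of_real (Im b))\<^sup>2"
          unfolding ak by simp
        also have "\<dots> = (of_real (a * (2 * s)) + \<i> * of_real (Im b))\<^sup>2"
          unfolding C_def by (subst (1) b_eq) (simp add: algebra_simps power2_eq_square)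
        finally show ?thesis by (simp only: b_eq[symmetric])
      qed
      moreover have "4 * complex_of_real a \<noteq> 0"
        using a by simp
      ultimately show ?thesis
        by (metis eq_divide_imp mult.commute)
    qed
    then have "exp (b\<^sup>2 / (4 * of_real a)) = exp C * of_real (exp (- (Im b * k)\<^sup>2 / 2))"
      by (metis exp_add exp_of_real)
    moreover have "sqrt (2 * pi) = sqrt (pi / a) / \<bar>k\<bar>"
      unfolding k_def using a by (simp add: real_sqrt_mult[symmetric])
    ultimately show ?thesis
      by (simp only: scaleR_conv_of_real of_real_mult of_real_divide of_real_inverse divide_inverse mult_ac)
  qed
  show ?thesis
  proof (rule iffD2[OF lborel_has_bochner_integral_real_affine_iff[where c = k and t = s]])
    show "k \<noteq> 0" using k(1) by simp
  qed (rule shifted[unfolded val])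
qed

lemma integrable_exp_quadratic:
  fixes a b :: real
  assumes "a > 0"
  shows "integrable lborel (\<lambda>x. exp (- (a * x\<^sup>2) + b * x))"
proof -
  have "integrable lborel (\<lambda>x. norm (exp (- (of_real a * (of_real x)\<^sup>2) + complex_of_real b * of_real x)))"
    using has_bochner_integral_complex_gaussian[OF assms, of "of_real b"]
    by (intro integrable_norm) (simp add: has_bochner_integral_iff)
  then show ?thesis
    by (simp add: norm_exp_eq_Re)
qed

lemma integral_exp_quadratic:
  fixes a b :: real
  assumes "a > 0"
  shows "(\<integral>x. exp (- (a * x\<^sup>2) + b * x) \<partial>lborel) = sqrt (pi / a) * exp (b\<^sup>2 / (4 * a))"
proof -
  have eq: "exp (- (of_real a * (of_real x)\<^sup>2) + complex_of_real b * of_real x)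
      = complex_of_real (exp (- (a * x\<^sup>2) + b * x))" for x
    unfolding exp_of_real[symmetric] by simp
  have "complex_of_real (\<integral>x. exp (- (a * x\<^sup>2) + b * x) \<partial>lborel) =
      of_real (sqrt (pi / a)) * exp ((of_real b)\<^sup>2 / (4 * of_real a))"
    using has_bochner_integral_complex_gaussian[OF assms, of "of_real b", unfolded eq]
    by (simp only: has_bochner_integral_iff integral_complex_of_real)
  also have "exp ((of_real b)\<^sup>2 / (4 * of_real a)) = complex_of_real (exp (b\<^sup>2 / (4 * a)))"
    unfolding exp_of_real[symmetric] by simp
  finally show ?thesis
    by (simp only: of_real_mult[symmetric] of_real_eq_iff)
qed

lemma nn_integral_exp_quadratic:
  fixes a b :: real
  assumes "a > 0"
  shows "(\<integral>\<^sup>+x. ennreal (exp (- (a * x\<^sup>2) + b * x)) \<partial>lborel) = ennreal (sqrt (pi / a) * exp (b\<^sup>2 / (4 * a)))"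
  using nn_integral_eq_integral[OF integrable_exp_quadratic[OF assms]] integral_exp_quadratic[OF assms] by simp

lemma nn_integral_complex_gaussian:
  assumes "\<nu> > 0"
  shows "(\<integral>\<^sup>+z. ennreal (exp (- (\<nu> * (cmod z)\<^sup>2))) \<partial>lborel) = ennreal (pi / \<nu>)"
proof -
  have g: "(\<integral>\<^sup>+x. ennreal (exp (- (\<nu> * x\<^sup>2))) \<partial>lborel) = ennreal (sqrt (pi / \<nu>))"
    using nn_integral_exp_quadratic[OF assms, of 0] by simp
  have split: "ennreal (exp (- (\<nu> * (cmod (Complex x y))\<^sup>2))) = ennreal (exp (- (\<nu> * x\<^sup>2))) * ennreal (exp (- (\<nu> * y\<^sup>2)))" for x y
    by (simp add: cmod_power2 ennreal_mult[symmetric] exp_add[symmetric] algebra_simps)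
  have "(\<integral>\<^sup>+z. ennreal (exp (- (\<nu> * (cmod z)\<^sup>2))) \<partial>lborel) = ennreal (sqrt (pi / \<nu>)) * ennreal (sqrt (pi / \<nu>))"
    by (subst nn_integral_Complex) (simp_all add: split nn_integral_cmult nn_integral_multc g)
  also have "\<dots> = ennreal (pi / \<nu>)"
    using assms by (simp add: ennreal_mult[symmetric])
  finally show ?thesis .
qed

text \<open>With \<open>a\<close>, \<open>b\<close> equal to \<open>z\<close>, \<open>w\<close>
  divided by \<open>sqrt 2\<close> and \<open>s = sqrt 2 * t\<close>, this is the kernel of the
  composition at a fixed \<open>t\<close>. The transform of the plane contributes - \<nu> to the
  coefficients of both x^2 and y^2, and exp(-\<nu> (x + i y)^2 / 2) contributes - \<nu>/2 and +
  \<nu>/2; hence 3\<nu>/2, \<nu>/2 and the cross term - i \<nu> x y inside \<open>Y\<close>.\<close>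

lemma two_dimensional_complex_gaussian:
  fixes \<nu> :: real and a b s :: complex
  assumes \<nu>: "\<nu> > 0"
  defines "Y \<equiv> \<lambda>x. of_real \<nu> * (2 * b + \<i> * (s - of_real x))"
  shows "(\<integral>x. (\<integral>y. exp (- (of_real (3 * \<nu> / 2) * (of_real x)\<^sup>2) + of_real \<nu> * (s + 2 * a) * of_real x
        + (- (of_real (\<nu> / 2) * (of_real y)\<^sup>2) + Y x * of_real y)) \<partial>lborel) \<partial>lborel) =
     of_real (pi / \<nu>) * exp (of_real \<nu> * (s * (a + \<i> * b) + a\<^sup>2 / 2 - \<i> * a * b + 3 * b\<^sup>2 / 2))"
proof -
  have inner: "(\<integral>y. exp (- (of_real (3 * \<nu> / 2) * (of_real x)\<^sup>2) + of_real \<nu> * (s + 2 * a) * of_real x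
        + (- (of_real (\<nu> / 2) * (of_real y)\<^sup>2) + Y x * of_real y)) \<partial>lborel) =
      of_real (sqrt (2 * pi / \<nu>)) * exp (of_real \<nu> * (2 * b\<^sup>2 + 2 * \<i> * b * s - s\<^sup>2 / 2)) *
      exp (- (of_real (2 * \<nu>) * (of_real x)\<^sup>2) + of_real (2 * \<nu>) * (s + a - \<i> * b) * of_real x)" for x
  proof -
    define U where "U = - (of_real (3 * \<nu> / 2) * (of_real x)\<^sup>2) + of_real \<nu> * (s + 2 * a) * of_real x"
    \<comment> \<open>Completing the square in \<open>y\<close> leaves \<open>q\<close>, whose x^2
      term - \<nu>/2 raises the rate in \<open>x\<close> from 3\<nu>/2 to 2\<nu>.\<close>
    define q where "q = of_real \<nu> * (2 * b + \<i> * (s - of_real x))\<^sup>2 / 2"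
    have q: "(Y x)\<^sup>2 / (4 * of_real (\<nu> / 2)) = q"
      using \<nu> by (simp add: Y_def q_def power_mult_distrib) (simp add: power2_eq_square)
    have "(\<integral>y. exp (- (of_real (\<nu> / 2) * (of_real y)\<^sup>2) + Y x * of_real y) \<partial>lborel) =
       of_real (sqrt (pi / (\<nu> / 2))) * exp ((Y x)\<^sup>2 / (4 * of_real (\<nu> / 2)))"
      by (rule has_bochner_integral_integral_eq[OF has_bochner_integral_complex_gaussian]) (use \<nu> in simp)
    moreover have "pi / (\<nu> / 2) = 2 * pi / \<nu>"
      by simp
    ultimately have Iy: "(\<integral>y. exp (- (of_real (\<nu> / 2) * (of_real y)\<^sup>2) + Y x * of_real y) \<partial>lborel) =
       of_real (sqrt (2 * pi / \<nu>)) * exp q"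
      by (simp only: q)
    have "U + q = of_real \<nu> * (2 * b\<^sup>2 + 2 * \<i> * b * s - s\<^sup>2 / 2) +
       (- (of_real (2 * \<nu>) * (of_real x)\<^sup>2) + of_real (2 * \<nu>) * (s + a - \<i> * b) * of_real x)"
      unfolding U_def q_def by (simp add: power2_eq_square algebra_simps add_divide_distrib diff_divide_distrib)
    then have "exp U * exp q = exp (of_real \<nu> * (2 * b\<^sup>2 + 2 * \<i> * b * s - s\<^sup>2 / 2)) *
       exp (- (of_real (2 * \<nu>) * (of_real x)\<^sup>2) + of_real (2 * \<nu>) * (s + a - \<i> * b) * of_real x)"
      by (simp only: exp_add[symmetric])
    moreover have "(\<integral>y. exp (U + (- (of_real (\<nu> / 2) * (of_real y)\<^sup>2) + Y x * of_real y)) \<partial>lborel) =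
       of_real (sqrt (2 * pi / \<nu>)) * (exp U * exp q)"
      unfolding exp_add[of U] integral_mult_right_zero Iy by (simp only: mult.left_commute)
    ultimately show ?thesis
      unfolding U_def by (simp only: mult.assoc)
  qed
  have outer: "(\<integral>x. exp (- (of_real (2 * \<nu>) * (of_real x)\<^sup>2) + of_real (2 * \<nu>) * (s + a - \<i> * b) * of_real x) \<partial>lborel) =
     of_real (sqrt (pi / (2 * \<nu>))) * exp (of_real \<nu> * (s + a - \<i> * b)\<^sup>2 / 2)"
  proof -
    have "(of_real (2 * \<nu>) * (s + a - \<i> * b))\<^sup>2 / (4 * of_real (2 * \<nu>)) = of_real \<nu> * (s + a - \<i> * b)\<^sup>2 / 2"
      using \<nu> by (simp add: power_mult_distrib) (simp add: power2_eq_square)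
    moreover have "2 * \<nu> > 0"
      using \<nu> by simp
    note has_bochner_integral_integral_eq[OF has_bochner_integral_complex_gaussian[OF this, of "of_real (2 * \<nu>) * (s + a - \<i> * b)"]]
    ultimately show ?thesis
      by (simp only:)
  qed
  have const: "sqrt (2 * pi / \<nu>) * sqrt (pi / (2 * \<nu>)) = pi / \<nu>"
  proof -
    have "sqrt (2 * pi / \<nu>) * sqrt (pi / (2 * \<nu>)) = sqrt ((pi / \<nu>)\<^sup>2)"
      unfolding real_sqrt_mult[symmetric] by (simp add: power2_eq_square)
    then show ?thesis using \<nu> by simp
  qed
  have "of_real \<nu> * (2 * b\<^sup>2 + 2 * \<i> * b * s - s\<^sup>2 / 2) + of_real \<nu> * (s + a - \<i> * b)\<^sup>2 / 2 =
      of_real \<nu> * (s * (a + \<i> * b) + a\<^sup>2 / 2 - \<i> * a * b + 3 * b\<^sup>2 / 2)"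
    by (simp add: power2_eq_square algebra_simps add_divide_distrib diff_divide_distrib)
  then have "exp (of_real \<nu> * (2 * b\<^sup>2 + 2 * \<i> * b * s - s\<^sup>2 / 2)) * exp (of_real \<nu> * (s + a - \<i> * b)\<^sup>2 / 2) =
      exp (of_real \<nu> * (s * (a + \<i> * b) + a\<^sup>2 / 2 - \<i> * a * b + 3 * b\<^sup>2 / 2))"
    by (simp only: exp_add[symmetric])
  moreover have "complex_of_real (sqrt (2 * pi / \<nu>)) * of_real (sqrt (pi / (2 * \<nu>))) = of_real (pi / \<nu>)"
    by (simp only: const of_real_mult[symmetric])
  moreover have "A * B * (C * D) = (A * C) * (B * D)" for A B C D :: complex
    by (simp only: mult_ac)
  ultimately show ?thesis
    unfolding inner integral_mult_right_zero outer by (simp only:)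
qed

subsection \<open>Continuity of translations in \<open>L\<^sup>2\<close>\<close>

lemma cmod_add_power2_le: "(cmod (a + b))\<^sup>2 \<le> 2 * (cmod a)\<^sup>2 + 2 * (cmod b)\<^sup>2"
proof -
  have "(cmod (a + b))\<^sup>2 \<le> (cmod a + cmod b)\<^sup>2"
    by (intro power_mono norm_triangle_ineq) simp
  also have "\<dots> \<le> 2 * (cmod a)\<^sup>2 + 2 * (cmod b)\<^sup>2"
    using sum_squares_bound[of "cmod a" "cmod b"] by (simp add: power2_sum)
  finally show ?thesis .
qed

text \<open>The factor is a product of two cutoffs: a trapezoid in \<open>x\<close>, and division by
  \<open>max 1 (cmod (h x) / M)\<close>, which pulls values back into the disc of radius
  \<open>M\<close>. It lies in [0, 1] and is eventually 1 at each point, so dominated convergence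
  applies with the square of \<open>h\<close> as majorant. It is written out because the next lemma
  applies the same formula to other functions.\<close>

lemma L2_approx_bounded_support:
  fixes h :: "real \<Rightarrow> complex"
  assumes [measurable]: "h \<in> borel_measurable borel"
    and h2: "integrable lborel (\<lambda>x. (cmod (h x))\<^sup>2)" and "e > 0"
  obtains M :: real where "M > 0"
    "(\<integral>x. (cmod (h x - of_real (max 0 (min 1 (M + 1 - \<bar>x\<bar>)) / max 1 (cmod (h x) / M)) * h x))\<^sup>2 \<partial>lborel) < e"
proof -
  define c where "c n x = max 0 (min 1 (real (Suc n) + 1 - \<bar>x\<bar>)) / max 1 (cmod (h x) / real (Suc n))" for n x
  have c01: "0 \<le> c n x" "c n x \<le> 1" for n x
    by (auto simp: c_def divide_le_eq)
  have [measurable]: "c n \<in> borel_measurable borel" for n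
    unfolding c_def by measurable
  have lim: "(\<lambda>n. (cmod (h x - of_real (c n x) * h x))\<^sup>2) \<longlonglongrightarrow> 0" for x
  proof (rule tendsto_eventually)
    obtain N :: nat where N: "real N \<ge> max \<bar>x\<bar> (cmod (h x))"
      using real_arch_simple by blast
    have "c n x = 1" if "n \<ge> N" for n
    proof -
      have "real (Suc n) \<ge> \<bar>x\<bar>" "real (Suc n) \<ge> cmod (h x)"
        using N that by auto
      then show ?thesis by (simp add: c_def max_def min_def divide_le_eq)
    qed
    then show "\<forall>\<^sub>F n in sequentially. (cmod (h x - of_real (c n x) * h x))\<^sup>2 = 0"
      by (auto simp: eventually_sequentially intro!: exI[of _ N])
  qed
  have bnd: "(cmod (h x - of_real (c n x) * h x))\<^sup>2 \<le> (cmod (h x))\<^sup>2" for n x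
  proof -
    have "h x - of_real (c n x) * h x = of_real (1 - c n x) * h x"
      by (simp add: algebra_simps)
    then have "cmod (h x - of_real (c n x) * h x) = (1 - c n x) * cmod (h x)"
      using c01[of n x] by (simp only: norm_mult norm_of_real)
    also have "\<dots> \<le> 1 * cmod (h x)"
      using c01[of n x] by (intro mult_right_mono) auto
    finally show ?thesis by (simp add: power_mono)
  qed
  have "(\<lambda>n. \<integral>x. (cmod (h x - of_real (c n x) * h x))\<^sup>2 \<partial>lborel) \<longlonglongrightarrow> (\<integral>x. 0 \<partial>(lborel :: real measure))"
    by (rule integral_dominated_convergence[OF _ _ h2]) (use lim bnd in auto)
  then have "\<forall>\<^sub>F n in sequentially. (\<integral>x. (cmod (h x - of_real (c n x) * h x))\<^sup>2 \<partial>lborel) < e"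
    using \<open>e > 0\<close> by (intro order_tendstoD) auto
  then obtain n where "(\<integral>x. (cmod (h x - of_real (c n x) * h x))\<^sup>2 \<partial>lborel) < e"
    by (auto simp: eventually_sequentially)
  then show ?thesis
    by (intro that[of "real (Suc n)"]) (auto simp: c_def)
qed

text \<open>A measurable \<open>h\<close> is almost everywhere a limit of continuous functions, but
  without any domination. Passing both \<open>h\<close> and these functions through the continuous
  cutoff \<open>T\<close> supplies a bound and a common compact support.\<close>

lemma L2_approx_continuous_compact_support:
  fixes h :: "real \<Rightarrow> complex"
  assumes hm [measurable]: "h \<in> borel_measurable borel"
    and h2: "integrable lborel (\<lambda>x. (cmod (h x))\<^sup>2)" and "e > 0"
  obtains g :: "real \<Rightarrow> complex" and M where
    "continuous_on UNIV g" "\<And>x. cmod (g x) \<le> M" "\<And>x. \<bar>x\<bar> > M \<Longrightarrow> g x = 0"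
    "integrable lborel (\<lambda>x. (cmod (h x - g x))\<^sup>2)"
    "(\<integral>x. (cmod (h x - g x))\<^sup>2 \<partial>lborel) < e"
proof -
  \<comment> \<open>The square of a sum costs a factor 2 on each of two errors, and 2 (e/4) + 2
    (e/4) = e.\<close>
  obtain M :: real where M: "M > 0" and
    le: "(\<integral>x. (cmod (h x - of_real (max 0 (min 1 (M + 1 - \<bar>x\<bar>)) / max 1 (cmod (h x) / M)) * h x))\<^sup>2 \<partial>lborel) < e / 4"
    using L2_approx_bounded_support[OF hm h2, of "e / 4"] \<open>e > 0\<close> by auto
  define T :: "real \<Rightarrow> complex \<Rightarrow> complex"
    where "T x z = of_real (max 0 (min 1 (M + 1 - \<bar>x\<bar>)) / max 1 (cmod z / M)) * z" for x z
  have T0: "T x z = 0" if "\<bar>x\<bar> > M + 1" for x z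
    using that by (simp add: T_def)
  have TM: "cmod (T x z) \<le> M" for x z
  proof -
    have "cmod (T x z) = max 0 (min 1 (M + 1 - \<bar>x\<bar>)) * (cmod z / max 1 (cmod z / M))"
      by (simp add: T_def norm_mult norm_divide)
    also have "\<dots> \<le> 1 * (cmod z / max 1 (cmod z / M))"
      by (intro mult_right_mono) auto
    also have "\<dots> \<le> M"
      using M by (auto simp: max_def field_simps)
    finally show ?thesis .
  qed
  have Tle: "cmod (z - T x z) \<le> cmod z" for x z
  proof -
    define c where "c = max 0 (min 1 (M + 1 - \<bar>x\<bar>)) / max 1 (cmod z / M)"
    have c01: "0 \<le> c" "c \<le> 1"
      by (auto simp: c_def divide_le_eq)
    have "z - T x z = of_real (1 - c) * z"
      by (simp add: T_def c_def algebra_simps)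
    then have "cmod (z - T x z) = (1 - c) * cmod z"
      using c01 by (simp only: norm_mult norm_of_real)
    also have "\<dots> \<le> 1 * cmod z"
      using c01 by (intro mult_right_mono) auto
    finally show ?thesis by simp
  qed
  have [measurable]: "(\<lambda>x. T x (h x)) \<in> borel_measurable borel"
    unfolding T_def by measurable
  \<comment> \<open>\<open>measurable_on\<close> is by definition convergence of continuous
    functions off a negligible set.\<close>
  have "h measurable_on UNIV"
    using hm by (simp add: measurable_on_iff_borel_measurable lebesgue_on_UNIV_eq measurable_completion)
  then obtain N g where N: "negligible N" and g: "\<And>n. continuous_on UNIV (g n)"
    and gh: "\<And>x. x \<notin> N \<Longrightarrow> (\<lambda>n. g n x) \<longlonglongrightarrow> h x"
    by (auto simp: measurable_on_def)
  have AE: "AE x in lborel. x \<notin> N"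
  proof -
    have "N \<in> null_sets lebesgue"
      using N by (simp add: negligible_iff_null_sets)
    then have "AE x in lebesgue. x \<notin> N"
      by (rule AE_not_in)
    then show ?thesis by (simp only: AE_completion_iff)
  qed
  have cont: "continuous_on UNIV (\<lambda>x. T x (g n x))" for n
    unfolding T_def using M by (intro continuous_intros g) (auto simp: max_def)
  then have [measurable]: "(\<lambda>x. T x (g n x)) \<in> borel_measurable borel" for n
    by (rule borel_measurable_continuous_onI)
  have lim: "(\<lambda>n. (cmod (T x (h x) - T x (g n x)))\<^sup>2) \<longlonglongrightarrow> 0" if "x \<notin> N" for x
  proof -
    have "isCont (T x) (h x)"
      unfolding T_def using M by (intro continuous_intros) (auto simp: max_def)
    then have "(\<lambda>n. T x (g n x)) \<longlonglongrightarrow> T x (h x)"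
      using gh[OF that] by (rule isCont_tendsto_compose)
    then have "(\<lambda>n. (cmod (T x (h x) - T x (g n x)))\<^sup>2) \<longlonglongrightarrow> (cmod (T x (h x) - T x (h x)))\<^sup>2"
      by (intro tendsto_intros)
    then show ?thesis by simp
  qed
  define w where "w x = (2 * M)\<^sup>2 * indicator {- (M + 1)..M + 1} x" for x :: real
  have bnd: "(cmod (T x (h x) - T x (g n x)))\<^sup>2 \<le> w x" for n x
  proof (cases "\<bar>x\<bar> > M + 1")
    case True
    then show ?thesis by (simp add: T0 w_def)
  next
    case False
    have "cmod (T x (h x) - T x (g n x)) \<le> 2 * M"
      using norm_triangle_ineq4[of "T x (h x)" "T x (g n x)"] TM[of x "h x"] TM[of x "g n x"] by linarith
    then have "(cmod (T x (h x) - T x (g n x)))\<^sup>2 \<le> (2 * M)\<^sup>2"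
      by (intro power_mono) auto
    with False show ?thesis by (auto simp: w_def indicator_def)
  qed
  have w: "integrable lborel w"
    unfolding w_def by (intro integrable_mult_right integrable_real_indicator) (auto simp: emeasure_lborel_Icc_eq)
  have dct: "AE x in lborel. (\<lambda>n. (cmod (T x (h x) - T x (g n x)))\<^sup>2) \<longlonglongrightarrow> 0"
     "AE x in lborel. norm ((cmod (T x (h x) - T x (g n x)))\<^sup>2) \<le> w x" for n
    using AE lim bnd by auto
  have "(\<lambda>n. \<integral>x. (cmod (T x (h x) - T x (g n x)))\<^sup>2 \<partial>lborel) \<longlonglongrightarrow> (\<integral>x. 0 \<partial>(lborel :: real measure))"
    by (rule integral_dominated_convergence[OF _ _ w dct]) measurable
  moreover have int: "integrable lborel (\<lambda>x. (cmod (T x (h x) - T x (g n x)))\<^sup>2)" for n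
    by (rule Bochner_Integration.integrable_bound[OF w]) (use bnd in \<open>auto intro: order_trans[OF _ abs_ge_self]\<close>)
  ultimately have "\<forall>\<^sub>F n in sequentially. (\<integral>x. (cmod (T x (h x) - T x (g n x)))\<^sup>2 \<partial>lborel) < e / 4"
    using \<open>e > 0\<close> by (intro order_tendstoD) auto
  then obtain n where n: "(\<integral>x. (cmod (T x (h x) - T x (g n x)))\<^sup>2 \<partial>lborel) < e / 4"
    by (auto simp: eventually_sequentially)
  have int1: "integrable lborel (\<lambda>x. (cmod (h x - T x (h x)))\<^sup>2)"
    by (rule Bochner_Integration.integrable_bound[OF h2]) (auto intro!: power_mono Tle)
  have int2: "integrable lborel (\<lambda>x. 2 * (cmod (h x - T x (h x)))\<^sup>2 + 2 * (cmod (T x (h x) - T x (g n x)))\<^sup>2)"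
    using int1 int by simp
  have sq: "(cmod (h x - T x (g n x)))\<^sup>2 \<le> 2 * (cmod (h x - T x (h x)))\<^sup>2 + 2 * (cmod (T x (h x) - T x (g n x)))\<^sup>2" for x
    using cmod_add_power2_le[of "h x - T x (h x)" "T x (h x) - T x (g n x)"] by simp
  have int3: "integrable lborel (\<lambda>x. (cmod (h x - T x (g n x)))\<^sup>2)"
    by (rule Bochner_Integration.integrable_bound[OF int2]) (use sq in auto)
  have "(\<integral>x. (cmod (h x - T x (g n x)))\<^sup>2 \<partial>lborel) \<le>
     (\<integral>x. 2 * (cmod (h x - T x (h x)))\<^sup>2 + 2 * (cmod (T x (h x) - T x (g n x)))\<^sup>2 \<partial>lborel)"
    by (intro integral_mono int2 int3 sq)
  also have "\<dots> < e"
    using n le int1 int[of n] unfolding T_def[symmetric] by simp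
  finally have less: "(\<integral>x. (cmod (h x - T x (g n x)))\<^sup>2 \<partial>lborel) < e" .
  show ?thesis
  proof (rule that[OF cont _ _ int3 less])
    show "cmod (T x (g n x)) \<le> M + 1" for x
      using TM[of x "g n x"] by simp
    show "T x (g n x) = 0" if "\<bar>x\<bar> > M + 1" for x
      by (rule T0[OF that])
  qed
qed

text \<open>For a continuous function of compact support this is dominated convergence. The general
  case follows by density, since a translate of the approximation error has the same norm as the
  error itself.\<close>

lemma L2_translation_continuous:
  fixes h :: "real \<Rightarrow> complex" and u :: "nat \<Rightarrow> real"
  assumes hm [measurable]: "h \<in> borel_measurable borel"
    and h2: "integrable lborel (\<lambda>x. (cmod (h x))\<^sup>2)" and u: "u \<longlonglongrightarrow> 0"
  shows "(\<lambda>n. \<integral>t. (cmod (h (t + u n) - h t))\<^sup>2 \<partial>lborel) \<longlonglongrightarrow> 0"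
proof (rule LIMSEQ_I)
  fix e :: real
  assume "e > 0"
  \<comment> \<open>The final estimate weighs the approximation error by 2 + 4 and the translation
    error of \<open>g\<close> by 4, and 6 (e/12) + 4 (e/8) = e.\<close>
  obtain g :: "real \<Rightarrow> complex" and M where g: "continuous_on UNIV g"
    and gM: "\<And>x. cmod (g x) \<le> M" and g0: "\<And>x. \<bar>x\<bar> > M \<Longrightarrow> g x = 0"
    and gi: "integrable lborel (\<lambda>x. (cmod (h x - g x))\<^sup>2)"
    and less: "(\<integral>x. (cmod (h x - g x))\<^sup>2 \<partial>lborel) < e / 12"
    using L2_approx_continuous_compact_support[OF hm h2, of "e / 12"] \<open>e > 0\<close> by auto
  have [measurable]: "g \<in> borel_measurable borel"
    using g by (rule borel_measurable_continuous_onI)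
  have "M \<ge> 0"
    using gM[of 0] norm_ge_zero order_trans by blast
  obtain C where C: "\<And>n. \<bar>u n\<bar> \<le> C"
    using convergent_imp_Bseq[OF convergentI[OF u]] by (auto simp: Bseq_def)
  \<comment> \<open>\<open>C\<close> bounds all shifts, so \<open>g\<close> and all its translates
    vanish outside the window of radius \<open>M + C\<close>, which gives one majorant for every
    \<open>n\<close>.\<close>
  define w where "w x = (2 * M)\<^sup>2 * indicator {- (M + C)..M + C} x" for x :: real
  have w: "integrable lborel w"
    unfolding w_def by (intro integrable_mult_right integrable_real_indicator) (auto simp: emeasure_lborel_Icc_eq)
  have bnd: "(cmod (g (t + u n) - g t))\<^sup>2 \<le> w t" for n t
  proof (cases "\<bar>t\<bar> > M + C")
    case True
    then have "\<bar>t\<bar> > M" "\<bar>t + u n\<bar> > M"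
      using C[of n] by linarith+
    then show ?thesis by (simp add: g0 w_def)
  next
    case False
    have "cmod (g (t + u n) - g t) \<le> 2 * M"
      using norm_triangle_ineq4[of "g (t + u n)" "g t"] gM[of "t + u n"] gM[of t] by linarith
    then have "(cmod (g (t + u n) - g t))\<^sup>2 \<le> (2 * M)\<^sup>2"
      by (intro power_mono) auto
    with False show ?thesis by (auto simp: w_def indicator_def)
  qed
  have lim: "(\<lambda>n. (cmod (g (t + u n) - g t))\<^sup>2) \<longlonglongrightarrow> 0" for t
  proof -
    have "isCont g t"
      using g by (simp add: continuous_on_eq_continuous_at)
    moreover have "(\<lambda>n. t + u n) \<longlonglongrightarrow> t"
      using tendsto_add[OF tendsto_const u, of t] by simp
    ultimately have "(\<lambda>n. g (t + u n)) \<longlonglongrightarrow> g t"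
      by (rule isCont_tendsto_compose)
    then have "(\<lambda>n. (cmod (g (t + u n) - g t))\<^sup>2) \<longlonglongrightarrow> (cmod (g t - g t))\<^sup>2"
      by (intro tendsto_intros)
    then show ?thesis by simp
  qed
  have dct: "AE t in lborel. (\<lambda>n. (cmod (g (t + u n) - g t))\<^sup>2) \<longlonglongrightarrow> 0"
     "AE t in lborel. norm ((cmod (g (t + u n) - g t))\<^sup>2) \<le> w t" for n
    using lim bnd by auto
  have "(\<lambda>n. \<integral>t. (cmod (g (t + u n) - g t))\<^sup>2 \<partial>lborel) \<longlonglongrightarrow> (\<integral>x. 0 \<partial>(lborel :: real measure))"
    by (rule integral_dominated_convergence[OF _ _ w dct]) measurable
  then have "\<forall>\<^sub>F n in sequentially. (\<integral>t. (cmod (g (t + u n) - g t))\<^sup>2 \<partial>lborel) < e / 8"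
    using \<open>e > 0\<close> by (intro order_tendstoD) auto
  then obtain N where N: "\<And>n. n \<ge> N \<Longrightarrow> (\<integral>t. (cmod (g (t + u n) - g t))\<^sup>2 \<partial>lborel) < e / 8"
    by (auto simp: eventually_sequentially)
  have "(\<integral>t. (cmod (h (t + u n) - h t))\<^sup>2 \<partial>lborel) < e" if "n \<ge> N" for n
  proof -
    have i1: "integrable lborel (\<lambda>t. (cmod (h (t + u n) - g (t + u n)))\<^sup>2)"
      using lborel_integrable_real_affine[OF gi, of 1 "u n"] by (simp add: add.commute)
    have e1: "(\<integral>t. (cmod (h (t + u n) - g (t + u n)))\<^sup>2 \<partial>lborel) = (\<integral>x. (cmod (h x - g x))\<^sup>2 \<partial>lborel)"
      using lborel_integral_real_affine[of 1 "\<lambda>x. (cmod (h x - g x))\<^sup>2" "u n"] by (simp add: add.commute)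
    have i2: "integrable lborel (\<lambda>t. (cmod (g (t + u n) - g t))\<^sup>2)"
      by (rule Bochner_Integration.integrable_bound[OF w]) (use bnd in \<open>auto intro: order_trans[OF _ abs_ge_self]\<close>)
    have i3: "integrable lborel (\<lambda>t. 2 * (cmod (h (t + u n) - g (t + u n)))\<^sup>2 +
        2 * (2 * (cmod (g (t + u n) - g t))\<^sup>2 + 2 * (cmod (h t - g t))\<^sup>2))"
      using i1 i2 gi by simp
    have sq: "(cmod (h (t + u n) - h t))\<^sup>2 \<le> 2 * (cmod (h (t + u n) - g (t + u n)))\<^sup>2 +
        2 * (2 * (cmod (g (t + u n) - g t))\<^sup>2 + 2 * (cmod (h t - g t))\<^sup>2)" for t
      using cmod_add_power2_le[of "h (t + u n) - g (t + u n)" "(g (t + u n) - g t) + (g t - h t)"]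
        cmod_add_power2_le[of "g (t + u n) - g t" "g t - h t"]
      by (simp add: norm_minus_commute)
    have i4: "integrable lborel (\<lambda>t. (cmod (h (t + u n) - h t))\<^sup>2)"
      by (rule Bochner_Integration.integrable_bound[OF i3]) (use sq in auto)
    have "(\<integral>t. (cmod (h (t + u n) - h t))\<^sup>2 \<partial>lborel) \<le>
      (\<integral>t. 2 * (cmod (h (t + u n) - g (t + u n)))\<^sup>2 +
        2 * (2 * (cmod (g (t + u n) - g t))\<^sup>2 + 2 * (cmod (h t - g t))\<^sup>2) \<partial>lborel)"
      by (intro integral_mono i3 i4 sq)
    also have "\<dots> = 2 * (\<integral>x. (cmod (h x - g x))\<^sup>2 \<partial>lborel) + 2 * (2 * (\<integral>t. (cmod (g (t + u n) - g t))\<^sup>2 \<partial>lborel)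
       + 2 * (\<integral>x. (cmod (h x - g x))\<^sup>2 \<partial>lborel))"
      using i1 i2 gi e1 by simp
    also have "\<dots> < e"
      using less N[OF that] by simp
    finally show ?thesis .
  qed
  then show "\<exists>no. \<forall>n\<ge>no. norm ((\<integral>t. (cmod (h (t + u n) - h t))\<^sup>2 \<partial>lborel) - 0) < e"
    by (intro exI[of _ N]) auto
qed

subsection \<open>Plancherel's theorem\<close>

lemma (in pair_sigma_finite) integrable_product_mult:
  fixes f :: "'a \<Rightarrow> 'c::{banach, second_countable_topology, real_normed_field}"
  assumes f: "integrable M1 f" and g: "integrable M2 g"
  shows "integrable (M1 \<Otimes>\<^sub>M M2) (\<lambda>(x, y). f x * g y)"
proof -
  have [measurable]: "f \<in> borel_measurable M1" "g \<in> borel_measurable M2"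
    using f g by auto
  show ?thesis
  proof (rule Fubini_integrable)
    show "integrable M1 (\<lambda>x. \<integral>y. norm (case (x, y) of (x, y) \<Rightarrow> f x * g y) \<partial>M2)"
      using f g by (simp add: norm_mult)
    show "AE x in M1. integrable M2 (\<lambda>y. case (x, y) of (x, y) \<Rightarrow> f x * g y)"
      using g by simp
  qed measurable
qed

lemma (in pair_sigma_finite) integral_product_mult:
  fixes f :: "'a \<Rightarrow> 'c::{banach, second_countable_topology, real_normed_field}"
  assumes f: "integrable M1 f" and g: "integrable M2 g"
  shows "(\<integral>(x, y). f x * g y \<partial>(M1 \<Otimes>\<^sub>M M2)) = (\<integral>x. f x \<partial>M1) * (\<integral>y. g y \<partial>M2)"
  using integral_fst[OF integrable_product_mult[OF f g]] f g by simp

lemma borel_measurable_cnj [measurable (raw)]: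
  "f \<in> borel_measurable M \<Longrightarrow> (\<lambda>x. cnj (f x)) \<in> borel_measurable M"
  by (rule borel_measurable_continuous_on[of cnj]) (auto intro: continuous_intros)

text \<open>All three parts compare \<open>h (t + u)\<close> with \<open>h t\<close> pointwise and
  use that translation preserves the norm. The last one is polarisation; it converts continuity of
  translations into continuity of the real part of the autocorrelation at 0.\<close>

lemma autocorrelation:
  fixes h :: "real \<Rightarrow> complex"
  assumes hm [measurable]: "h \<in> borel_measurable borel"
    and h2: "integrable lborel (\<lambda>t. (cmod (h t))\<^sup>2)"
  shows integrable_autocorrelation: "integrable lborel (\<lambda>t. h (t + u) * cnj (h t))"
    and integral_norm_autocorrelation_le:
      "(\<integral>t. cmod (h (t + u) * cnj (h t)) \<partial>lborel) \<le> (\<integral>t. (cmod (h t))\<^sup>2 \<partial>lborel)"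
    and Re_autocorrelation: "Re (\<integral>t. h (t + u) * cnj (h t) \<partial>lborel) =
      (\<integral>t. (cmod (h t))\<^sup>2 \<partial>lborel) - (\<integral>t. (cmod (h (t + u) - h t))\<^sup>2 \<partial>lborel) / 2"
proof -
  have i1: "integrable lborel (\<lambda>t. (cmod (h (t + u)))\<^sup>2)"
    using lborel_integrable_real_affine[OF h2, of 1 u] by (simp add: add.commute)
  have e1: "(\<integral>t. (cmod (h (t + u)))\<^sup>2 \<partial>lborel) = (\<integral>t. (cmod (h t))\<^sup>2 \<partial>lborel)"
    using lborel_integral_real_affine[of 1 "\<lambda>t. (cmod (h t))\<^sup>2" u] by (simp add: add.commute)
  have i2: "integrable lborel (\<lambda>t. ((cmod (h (t + u)))\<^sup>2 + (cmod (h t))\<^sup>2) / 2)"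
    using i1 h2 by simp
  have le: "cmod (h (t + u) * cnj (h t)) \<le> ((cmod (h (t + u)))\<^sup>2 + (cmod (h t))\<^sup>2) / 2" for t
    using sum_squares_bound[of "cmod (h (t + u))" "cmod (h t)"] by (simp add: norm_mult)
  show i3: "integrable lborel (\<lambda>t. h (t + u) * cnj (h t))"
    by (rule Bochner_Integration.integrable_bound[OF i2])
      (use le in \<open>auto intro!: AE_I2 intro: order_trans[OF _ abs_ge_self]\<close>)
  have "(\<integral>t. cmod (h (t + u) * cnj (h t)) \<partial>lborel) \<le> (\<integral>t. ((cmod (h (t + u)))\<^sup>2 + (cmod (h t))\<^sup>2) / 2 \<partial>lborel)"
    by (intro integral_mono integrable_norm i3 i2 le)
  also have "\<dots> = (\<integral>t. (cmod (h t))\<^sup>2 \<partial>lborel)"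
    using i1 h2 e1 by simp
  finally show "(\<integral>t. cmod (h (t + u) * cnj (h t)) \<partial>lborel) \<le> (\<integral>t. (cmod (h t))\<^sup>2 \<partial>lborel)" .
  define r where "r t = Re (h (t + u) * cnj (h t))" for t
  have r: "integrable lborel r" "Re (\<integral>t. h (t + u) * cnj (h t) \<partial>lborel) = (\<integral>t. r t \<partial>lborel)"
    unfolding r_def using integrable_Re[OF i3] integral_Re[OF i3] by simp_all
  have pol: "(cmod (h (t + u) - h t))\<^sup>2 = (cmod (h (t + u)))\<^sup>2 + (cmod (h t))\<^sup>2 - 2 * r t" for t
    unfolding r_def by (simp only: cmod_power2) (simp add: algebra_simps power2_eq_square)
  have "(\<integral>t. (cmod (h (t + u) - h t))\<^sup>2 \<partial>lborel) =
      2 * (\<integral>t. (cmod (h t))\<^sup>2 \<partial>lborel) - 2 * (\<integral>t. r t \<partial>lborel)"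
    unfolding pol using i1 h2 e1 r(1) by simp
  then show "Re (\<integral>t. h (t + u) * cnj (h t) \<partial>lborel) =
      (\<integral>t. (cmod (h t))\<^sup>2 \<partial>lborel) - (\<integral>t. (cmod (h (t + u) - h t))\<^sup>2 \<partial>lborel) / 2"
    unfolding r(2) by (simp add: field_simps)
qed

text \<open>
  The right-hand side averages the autocorrelation of \<open>h\<close> against a Gaussian concentrating at 0 as
  \<open>a\<close> tends to 0.
\<close>

lemma gaussian_weighted_Fourier_norm:
  fixes h :: "real \<Rightarrow> complex" and a :: real
  assumes hm [measurable]: "h \<in> borel_measurable borel"
    and h1: "integrable lborel h" and h2: "integrable lborel (\<lambda>t. (cmod (h t))\<^sup>2)"
    and a: "a > 0"
  defines "F \<equiv> \<lambda>y. \<integral>t. h t * exp (\<i> * of_real (t * y)) \<partial>lborel"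
  shows "integrable lborel (\<lambda>y. (cmod (F y))\<^sup>2 * exp (- (a * y\<^sup>2)))"
    and "integrable lborel (\<lambda>v. exp (- v\<^sup>2) * Re (\<integral>t. h (t + 2 * sqrt a * v) * cnj (h t) \<partial>lborel))"
    and "(\<integral>y. (cmod (F y))\<^sup>2 * exp (- (a * y\<^sup>2)) \<partial>lborel) =
      2 * sqrt pi * (\<integral>v. exp (- v\<^sup>2) * Re (\<integral>t. h (t + 2 * sqrt a * v) * cnj (h t) \<partial>lborel) \<partial>lborel)"
proof -
  \<comment> \<open>The Fourier transform of exp(-a y^2) is a multiple of exp(-r^2 / (4 a)); the
    scale \<open>c\<close> in r = c v turns this into exp(-v^2), whatever \<open>a\<close>
    is.\<close>
  define c where "c = 2 * sqrt a"
  have c: "c > 0" using a by (simp add: c_def)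
  define E :: "real \<Rightarrow> complex" where "E y = of_real (exp (- (a * y\<^sup>2)))" for y
  define P :: "real \<times> real \<Rightarrow> complex" where "P = (\<lambda>(s, t). h s * cnj (h t))"
  define D :: "real \<times> real \<Rightarrow> real" where "D p = fst p - snd p" for p
  have [measurable]: "D \<in> borel_measurable borel"
    unfolding D_def by (intro borel_measurable_continuous_onI continuous_intros)
  \<comment> \<open>The squared modulus of \<open>F y\<close> is a double integral of h(s) cnj(h(t))
    exp(i (s - t) y) over \<open>p = (s, t)\<close>. With the damping \<open>E\<close> the integrand
    \<open>K\<close> is absolutely integrable in all three variables, because \<open>h\<close> is
    integrable.\<close>
  define K :: "real \<times> real \<Rightarrow> real \<Rightarrow> complex"
    where "K p y = P p * E y * exp (\<i> * of_real (D p * y))" for p y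
  have [measurable]: "E \<in> borel_measurable borel" "P \<in> borel_measurable borel"
    unfolding E_def P_def borel_prod[symmetric] by measurable
  have gauss: "integrable lborel (\<lambda>x. exp (- (b * x\<^sup>2)))" if "b > 0" for b :: real
    using integrable_exp_quadratic[OF that, of 0] by simp
  have Ei: "integrable lborel E"
    unfolding E_def by (intro integrable_of_real gauss a)
  have Pi: "integrable lborel P"
    unfolding lborel_prod[symmetric] P_def
    using lborel_pair.integrable_product_mult[OF h1 integrable_cnj[OF h1]] by simp
  have PE: "integrable (lborel \<Otimes>\<^sub>M lborel) (\<lambda>(p, y). P p * E y)"
    by (rule lborel_pair.integrable_product_mult[OF Pi Ei])
  have "(\<lambda>(p, y). K p y) \<in> borel_measurable (lborel \<Otimes>\<^sub>M lborel)"
    unfolding K_def case_prod_beta by measurable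
  then have Ki: "integrable (lborel \<Otimes>\<^sub>M lborel) (\<lambda>(p, y). K p y)"
    by (rule Bochner_Integration.integrable_bound[OF PE])
      (auto simp: K_def norm_mult norm_exp_i_times simp del: of_real_mult of_real_diff)
  have osc: "integrable lborel (\<lambda>t. h t * exp (\<i> * of_real (t * y)))" for y
    by (rule Bochner_Integration.integrable_bound[OF h1]) (auto simp: norm_mult norm_exp_i_times simp del: of_real_mult)
  have Fy: "of_real ((cmod (F y))\<^sup>2 * exp (- (a * y\<^sup>2))) = (\<integral>p. K p y \<partial>lborel)" for y
  proof -
    have cn: "cnj (exp (\<i> * (of_real t * of_real y))) = inverse (exp (\<i> * (of_real t * of_real y)))" for t y :: real
      unfolding exp_cnj exp_minus[symmetric] by simp
    define w where "w t = h t * exp (\<i> * of_real (t * y))" for t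
    have w: "integrable lborel w" "F y = (\<integral>t. w t \<partial>lborel)"
      using osc[of y] unfolding w_def F_def by simp_all
    have K: "K p y = E y * (case p of (s, t) \<Rightarrow> w s * cnj (w t))" for p
      using cn[of _ y] by (cases p) (simp add: K_def P_def D_def w_def exp_add[symmetric] algebra_simps exp_diff exp_minus divide_inverse)
    have "(\<integral>p. K p y \<partial>lborel) = E y * (F y * cnj (F y))"
      unfolding K lborel_prod[symmetric] w(2)
      using lborel_pair.integral_product_mult[OF w(1) integrable_cnj[OF w(1)]] by simp
    then show ?thesis
      by (simp add: E_def complex_norm_square[symmetric] mult.commute)
  qed
  \<comment> \<open>\<open>G\<close> is the Fourier transform of the damping, to be taken at
    \<open>D p\<close>, the difference s - t.\<close>
  define G :: "real \<Rightarrow> complex" where "G r = of_real (sqrt (pi / a) * exp (- (r\<^sup>2 / (4 * a))))" for r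
  have Ky: "(\<integral>y. K p y \<partial>lborel) = P p * G (D p)" for p
  proof -
    have K: "K p y = P p * exp (- (of_real a * (of_real y)\<^sup>2) + (\<i> * of_real (D p)) * of_real y)" for y
      unfolding K_def E_def exp_of_real[symmetric] mult.assoc exp_add[symmetric] by (simp add: mult.assoc)
    have "(\<i> * of_real (D p))\<^sup>2 / (4 * of_real a) = complex_of_real (- ((D p)\<^sup>2 / (4 * a)))"
      by (simp add: power_mult_distrib)
    then have "(\<integral>y. exp (- (of_real a * (of_real y)\<^sup>2) + (\<i> * of_real (D p)) * of_real y) \<partial>lborel) = G (D p)"
      using has_bochner_integral_complex_gaussian[OF a, of "\<i> * of_real (D p)"]
      by (simp only: has_bochner_integral_iff G_def of_real_mult exp_of_real)
    then show ?thesis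
      unfolding K by simp
  qed
  have F1: "integrable lborel (\<lambda>y. complex_of_real ((cmod (F y))\<^sup>2 * exp (- (a * y\<^sup>2))))"
    unfolding Fy by (rule lborel_pair.integrable_snd[OF Ki])
  from integrable_Re[OF this] show int_F: "integrable lborel (\<lambda>y. (cmod (F y))\<^sup>2 * exp (- (a * y\<^sup>2)))"
    by (simp only: Re_complex_of_real)
  have Li: "integrable lborel (\<lambda>p. P p * G (D p))"
    using lborel_pair.integrable_fst[OF Ki] unfolding Ky .
  have pair: "(\<lambda>(s, t). P (s, t) * G (s - t)) = (\<lambda>p. P p * G (D p))"
    by (auto simp: D_def fun_eq_iff)
  have Li': "integrable (lborel \<Otimes>\<^sub>M lborel) (\<lambda>(s, t). P (s, t) * G (s - t))"
    unfolding pair lborel_prod by (rule Li)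
  define Q where "Q v t = complex_of_real (exp (- v\<^sup>2)) * (h (t + c * v) * cnj (h t))" for v t
  have Gc: "c * G (c * v) = 2 * sqrt pi * exp (- v\<^sup>2)" for v
  proof -
    have "(c * v)\<^sup>2 / (4 * a) = v\<^sup>2"
      using a by (simp add: c_def power_mult_distrib)
    moreover have "c * sqrt (pi / a) = 2 * sqrt pi"
      using a by (simp add: c_def real_sqrt_divide)
    ultimately have "c * (sqrt (pi / a) * exp (- ((c * v)\<^sup>2 / (4 * a)))) = 2 * sqrt pi * exp (- v\<^sup>2)"
      by (simp only: mult.assoc[symmetric])
    then show ?thesis
      unfolding G_def by (metis of_real_mult of_real_numeral)
  qed
  \<comment> \<open>Substituting s = t + c v exhibits a shift of \<open>h\<close> by
    \<open>c * v\<close>, and the Jacobian \<open>c\<close> combines with \<open>G\<close> into a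
    constant independent of \<open>a\<close>.\<close>
  have sub: "(\<integral>s. P (s, t) * G (s - t) \<partial>lborel) = of_real (2 * sqrt pi) * (\<integral>v. Q v t \<partial>lborel)" for t
  proof -
    have "(\<integral>s. P (s, t) * G (s - t) \<partial>lborel) = c *\<^sub>R (\<integral>v. P (t + c * v, t) * G (t + c * v - t) \<partial>lborel)"
      using lborel_integral_real_affine[of c "\<lambda>s. P (s, t) * G (s - t)" t] c by simp
    also have "\<dots> = (\<integral>v. of_real c * (P (t + c * v, t) * G (t + c * v - t)) \<partial>lborel)"
      by (simp add: scaleR_conv_of_real)
    also have "(\<lambda>v. of_real c * (P (t + c * v, t) * G (t + c * v - t))) = (\<lambda>v. of_real (2 * sqrt pi) * Q v t)"
    proof
      fix v
      have "of_real c * (P (t + c * v, t) * G (t + c * v - t)) = P (t + c * v, t) * (of_real c * G (c * v))"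
        by simp
      then show "of_real c * (P (t + c * v, t) * G (t + c * v - t)) = of_real (2 * sqrt pi) * Q v t"
        unfolding Gc by (simp add: Q_def P_def)
    qed
    finally show ?thesis by simp
  qed
  have [measurable]: "(\<lambda>(v, t). Q v t) \<in> borel_measurable (lborel \<Otimes>\<^sub>M lborel)"
    unfolding Q_def by measurable
  \<comment> \<open>For fixed \<open>v\<close> the integral over \<open>t\<close> of the modulus is
    at most exp(-v^2) times the squared norm of \<open>h\<close>, which licenses the second
    exchange.\<close>
  have Qi: "integrable (lborel \<Otimes>\<^sub>M lborel) (\<lambda>(v, t). Q v t)"
  proof (rule lborel_pair.Fubini_integrable)
    show "AE v in lborel. integrable lborel (\<lambda>t. case (v, t) of (v, t) \<Rightarrow> Q v t)"
      using integrable_autocorrelation[OF hm h2] by (simp add: Q_def)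
    have "integrable lborel (\<lambda>v. exp (- (1 * v\<^sup>2)) * (\<integral>t. (cmod (h t))\<^sup>2 \<partial>lborel))"
      by (intro integrable_mult_left gauss) simp
    then show "integrable lborel (\<lambda>v. \<integral>t. norm (case (v, t) of (v, t) \<Rightarrow> Q v t) \<partial>lborel)"
    proof (rule Bochner_Integration.integrable_bound)
      show "AE v in lborel. norm (\<integral>t. norm (case (v, t) of (v, t) \<Rightarrow> Q v t) \<partial>lborel) \<le>
          norm (exp (- (1 * v\<^sup>2)) * (\<integral>t. (cmod (h t))\<^sup>2 \<partial>lborel))"
      proof (rule AE_I2)
        fix v :: real
        have "(\<integral>t. norm (case (v, t) of (v, t) \<Rightarrow> Q v t) \<partial>lborel) =
            exp (- v\<^sup>2) * (\<integral>t. cmod (h (t + c * v) * cnj (h t)) \<partial>lborel)"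
          by (simp add: Q_def norm_mult)
        then show "norm (\<integral>t. norm (case (v, t) of (v, t) \<Rightarrow> Q v t) \<partial>lborel) \<le>
          norm (exp (- (1 * v\<^sup>2)) * (\<integral>t. (cmod (h t))\<^sup>2 \<partial>lborel))"
          using integral_norm_autocorrelation_le[OF hm h2, of "c * v"] by (simp add: abs_mult)
      qed
    qed measurable
  qed measurable
  have Q1: "(\<integral>t. Q v t \<partial>lborel) = of_real (exp (- v\<^sup>2)) * (\<integral>t. h (t + c * v) * cnj (h t) \<partial>lborel)" for v
    unfolding Q_def by simp
  have Q2: "integrable lborel (\<lambda>v. of_real (exp (- v\<^sup>2)) * (\<integral>t. h (t + c * v) * cnj (h t) \<partial>lborel))"
    using lborel_pair.integrable_fst[OF Qi] unfolding Q1 .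
  have Re_eq: "Re (of_real r * z) = r * Re z" for r z
    by simp
  show "integrable lborel (\<lambda>v. exp (- v\<^sup>2) * Re (\<integral>t. h (t + 2 * sqrt a * v) * cnj (h t) \<partial>lborel))"
    using integrable_Re[OF Q2] unfolding Re_eq c_def .
  have "complex_of_real (\<integral>y. (cmod (F y))\<^sup>2 * exp (- (a * y\<^sup>2)) \<partial>lborel) = (\<integral>y. (\<integral>p. K p y \<partial>lborel) \<partial>lborel)"
    unfolding integral_complex_of_real[symmetric] Fy by (rule refl)
  also have "\<dots> = (\<integral>p. (\<integral>y. K p y \<partial>lborel) \<partial>lborel)"
    by (rule lborel_pair.Fubini_integral[OF Ki])
  also have "\<dots> = (\<integral>(s, t). P (s, t) * G (s - t) \<partial>(lborel \<Otimes>\<^sub>M lborel))"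
    unfolding Ky lborel_prod pair by (rule refl)
  also have "\<dots> = (\<integral>t. (\<integral>s. P (s, t) * G (s - t) \<partial>lborel) \<partial>lborel)"
    by (rule lborel_pair.integral_snd[OF Li', symmetric])
  also have "\<dots> = of_real (2 * sqrt pi) * (\<integral>t. (\<integral>v. Q v t \<partial>lborel) \<partial>lborel)"
    unfolding sub by simp
  also have "(\<integral>t. (\<integral>v. Q v t \<partial>lborel) \<partial>lborel) = (\<integral>v. (\<integral>t. Q v t \<partial>lborel) \<partial>lborel)"
    by (rule lborel_pair.Fubini_integral[OF Qi])
  finally have "complex_of_real (\<integral>y. (cmod (F y))\<^sup>2 * exp (- (a * y\<^sup>2)) \<partial>lborel) =
     of_real (2 * sqrt pi) * (\<integral>v. of_real (exp (- v\<^sup>2)) * (\<integral>t. h (t + c * v) * cnj (h t) \<partial>lborel) \<partial>lborel)"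
    unfolding Q1 .
  from arg_cong[where f = Re, OF this]
  have "(\<integral>y. (cmod (F y))\<^sup>2 * exp (- (a * y\<^sup>2)) \<partial>lborel) =
     2 * sqrt pi * Re (\<integral>v. of_real (exp (- v\<^sup>2)) * (\<integral>t. h (t + c * v) * cnj (h t) \<partial>lborel) \<partial>lborel)"
    by (simp only: Re_complex_of_real Re_eq)
  moreover have "(\<integral>v. exp (- v\<^sup>2) * Re (\<integral>t. h (t + c * v) * cnj (h t) \<partial>lborel) \<partial>lborel) =
      Re (\<integral>v. of_real (exp (- v\<^sup>2)) * (\<integral>t. h (t + c * v) * cnj (h t) \<partial>lborel) \<partial>lborel)"
    using integral_Re[OF Q2] by (simp only: Re_eq)
  ultimately show "(\<integral>y. (cmod (F y))\<^sup>2 * exp (- (a * y\<^sup>2)) \<partial>lborel) =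
      2 * sqrt pi * (\<integral>v. exp (- v\<^sup>2) * Re (\<integral>t. h (t + 2 * sqrt a * v) * cnj (h t) \<partial>lborel) \<partial>lborel)"
    by (simp only: c_def)
qed

text \<open>Removing the damping uses a different convergence theorem on each side: the weights
  increase to 1, so the Fourier side converges monotonically, with no integrability known in
  advance; the averaged autocorrelation is dominated by its value \<open>N\<close> at shift
  0.\<close>

theorem Plancherel_L1_L2:
  fixes h :: "real \<Rightarrow> complex"
  assumes hm [measurable]: "h \<in> borel_measurable borel"
    and h1: "integrable lborel h" and h2: "integrable lborel (\<lambda>t. (cmod (h t))\<^sup>2)"
  shows "(\<integral>\<^sup>+y. ennreal ((cmod (\<integral>t. h t * exp (\<i> * of_real (t * y)) \<partial>lborel))\<^sup>2) \<partial>lborel) =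
    ennreal (2 * pi * (\<integral>t. (cmod (h t))\<^sup>2 \<partial>lborel))"
proof -
  define F where "F y = (\<integral>t. h t * exp (\<i> * of_real (t * y)) \<partial>lborel)" for y
  define N where "N = (\<integral>t. (cmod (h t))\<^sup>2 \<partial>lborel)"
  define A where "A u = (\<integral>t. h (t + u) * cnj (h t) \<partial>lborel)" for u
  \<comment> \<open>The square makes \<open>sqrt (a n)\<close>, and so the shift below, an explicit
    null sequence.\<close>
  define a where "a n = (1 / real (Suc n))\<^sup>2" for n
  have a: "a n > 0" "sqrt (a n) = 1 / real (Suc n)" for n
    by (auto simp: a_def simp del: of_nat_Suc)
  have [measurable]: "F \<in> borel_measurable borel"
    unfolding F_def by measurable
  define I where "I n = (\<integral>y. (cmod (F y))\<^sup>2 * exp (- (a n * y\<^sup>2)) \<partial>lborel)" for n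
  note reg = gaussian_weighted_Fourier_norm[OF hm h1 h2 a(1), folded F_def A_def]
  have gauss: "integrable lborel (\<lambda>v. exp (- v\<^sup>2) * N)"
    using integrable_exp_quadratic[of 1 0] by simp
  have AN: "(\<lambda>n. Re (A (2 * sqrt (a n) * v))) \<longlonglongrightarrow> N" for v
  proof -
    have "(\<lambda>n. 1 / real (Suc n)) \<longlonglongrightarrow> 0"
      using LIMSEQ_inverse_real_of_nat by (simp add: inverse_eq_divide)
    then have "(\<lambda>n. 2 * sqrt (a n) * v) \<longlonglongrightarrow> 2 * 0 * v"
      unfolding a(2) by (intro tendsto_intros)
    then have "(\<lambda>n. 2 * sqrt (a n) * v) \<longlonglongrightarrow> 0"
      by simp
    from L2_translation_continuous[OF hm h2 this]
    have "(\<lambda>n. N - (\<integral>t. (cmod (h (t + 2 * sqrt (a n) * v) - h t))\<^sup>2 \<partial>lborel) / 2) \<longlonglongrightarrow> N - 0 / 2"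
      by (intro tendsto_intros) simp_all
    then show ?thesis
      unfolding A_def Re_autocorrelation[OF hm h2] N_def by simp
  qed
  have bnd: "\<bar>Re (A u)\<bar> \<le> N" for u
  proof -
    have "\<bar>Re (A u)\<bar> \<le> cmod (A u)"
      by (rule abs_Re_le_cmod)
    also have "\<dots> \<le> (\<integral>t. cmod (h (t + u) * cnj (h t)) \<partial>lborel)"
      unfolding A_def by (rule integral_norm_bound)
    also have "\<dots> \<le> N"
      unfolding N_def by (rule integral_norm_autocorrelation_le[OF hm h2])
    finally show ?thesis .
  qed
  have "(\<lambda>n. \<integral>v. exp (- v\<^sup>2) * Re (A (2 * sqrt (a n) * v)) \<partial>lborel) \<longlonglongrightarrow> (\<integral>v. exp (- v\<^sup>2) * N \<partial>lborel)"
  proof (rule integral_dominated_convergence[OF _ _ gauss])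
    show "AE v in lborel. (\<lambda>n. exp (- v\<^sup>2) * Re (A (2 * sqrt (a n) * v))) \<longlonglongrightarrow> exp (- v\<^sup>2) * N"
      by (intro AE_I2 tendsto_intros AN)
    show "AE v in lborel. norm (exp (- v\<^sup>2) * Re (A (2 * sqrt (a n) * v))) \<le> exp (- v\<^sup>2) * N" for n
      using bnd by (simp add: abs_mult)
    show "(\<lambda>v. exp (- v\<^sup>2) * Re (A (2 * sqrt (a n) * v))) \<in> borel_measurable lborel" for n
      by (rule borel_measurable_integrable[OF reg(2)])
  qed measurable
  moreover have "(\<integral>v. exp (- v\<^sup>2) * N \<partial>lborel) = sqrt pi * N"
    using integral_exp_quadratic[of 1 0] by simp
  ultimately have "I \<longlonglongrightarrow> 2 * sqrt pi * (sqrt pi * N)"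
    unfolding I_def reg(3) by (auto intro!: tendsto_intros)
  moreover have "2 * sqrt pi * (sqrt pi * N) = 2 * (sqrt pi * sqrt pi) * N"
    by (simp only: mult_ac)
  ultimately have "I \<longlonglongrightarrow> 2 * pi * N"
    by simp
  then have lim1: "(\<lambda>n. ennreal (I n)) \<longlonglongrightarrow> ennreal (2 * pi * N)"
    by (rule tendsto_ennrealI)
  define f where "f n y = ennreal ((cmod (F y))\<^sup>2 * exp (- (a n * y\<^sup>2)))" for n y
  have [measurable]: "f n \<in> borel_measurable lborel" for n
    unfolding f_def by measurable
  have a_mono: "a n \<le> a m" if "m \<le> n" for m n
    unfolding a_def using that by (intro power_mono divide_left_mono) auto
  have inc: "incseq f"
    unfolding incseq_def le_fun_def f_def
    by (auto intro!: ennreal_leI mult_left_mono mult_right_mono a_mono)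
  have "(SUP n. f n y) = ennreal ((cmod (F y))\<^sup>2)" for y
  proof (rule LIMSEQ_unique[OF LIMSEQ_SUP])
    show "incseq (\<lambda>n. f n y)"
      using inc by (auto simp: incseq_def le_fun_def)
    have "(\<lambda>n. 1 / real (Suc n)) \<longlonglongrightarrow> 0"
      using LIMSEQ_inverse_real_of_nat by (simp add: inverse_eq_divide)
    then have "(\<lambda>n. (cmod (F y))\<^sup>2 * exp (- (a n * y\<^sup>2))) \<longlonglongrightarrow> (cmod (F y))\<^sup>2 * exp (- (0\<^sup>2 * y\<^sup>2))"
      unfolding a_def by (intro tendsto_intros)
    then show "(\<lambda>n. f n y) \<longlonglongrightarrow> ennreal ((cmod (F y))\<^sup>2)"
      unfolding f_def by (intro tendsto_ennrealI) simp
  qed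
  then have "(\<integral>\<^sup>+y. ennreal ((cmod (F y))\<^sup>2) \<partial>lborel) = (SUP n. \<integral>\<^sup>+y. f n y \<partial>lborel)"
    using nn_integral_monotone_convergence_SUP[OF inc, of lborel] by simp
  moreover have fI: "(\<integral>\<^sup>+y. f n y \<partial>lborel) = ennreal (I n)" for n
    unfolding f_def I_def by (rule nn_integral_eq_integral[OF reg(1)]) simp
  moreover have "incseq (\<lambda>n. \<integral>\<^sup>+y. f n y \<partial>lborel)"
    using inc by (auto simp: incseq_def le_fun_def intro!: nn_integral_mono)
  then have "(\<lambda>n. \<integral>\<^sup>+y. f n y \<partial>lborel) \<longlonglongrightarrow> (SUP n. \<integral>\<^sup>+y. f n y \<partial>lborel)"
    by (rule LIMSEQ_SUP)
  ultimately have "(\<lambda>n. ennreal (I n)) \<longlonglongrightarrow> (\<integral>\<^sup>+y. ennreal ((cmod (F y))\<^sup>2) \<partial>lborel)"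
    by simp
  from LIMSEQ_unique[OF this lim1] show ?thesis
    unfolding F_def N_def .
qed

subsection \<open>The one-dimensional transform\<close>

lemma sum_power_fact_le_exp:
  fixes x :: real
  assumes "x \<ge> 0"
  shows "(\<Sum>i<n. x ^ i / fact i) \<le> exp x"
proof -
  have "(\<lambda>i. x ^ i / fact i) sums exp x"
    using exp_converges[of x] by (simp add: divide_inverse mult.commute)
  then show ?thesis
    using sum_le_suminf[of "\<lambda>i. x ^ i / fact i" "{..<n}"] assms
    by (auto simp: sums_iff)
qed

text \<open>The exponential series is integrated term by term; its partial sums are dominated by the
  integrable \<open>cmod (g t) * exp (cmod z * \<bar>t\<bar>)\<close>. The result is a power series
  converging at every point, hence differentiable everywhere.\<close>

lemma entire_exponential_transform:
  fixes g :: "real \<Rightarrow> complex"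
  assumes [measurable]: "g \<in> borel_measurable borel"
    and int: "\<And>R. integrable lborel (\<lambda>t. cmod (g t) * exp (R * \<bar>t\<bar>))"
  shows "\<exists>D. ((\<lambda>z. \<integral>t. g t * exp (of_real t * z) \<partial>lborel) has_field_derivative D) (at z)"
proof -
  define c where "c n = (\<integral>t. g t * of_real (t ^ n / fact n) \<partial>lborel)" for n
  have sums: "(\<lambda>n. c n * z ^ n) sums (\<integral>t. g t * exp (of_real t * z) \<partial>lborel)" for z
  proof -
    define s where "s n t = (\<Sum>i<n. g t * ((of_real t * z) ^ i / fact i))" for n t
    have [measurable]: "s n \<in> borel_measurable borel" for n
      unfolding s_def by measurable
    have bnd: "(\<Sum>i<n. (\<bar>t\<bar> * cmod z) ^ i / fact i) \<le> exp (cmod z * \<bar>t\<bar>)" for n t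
      using sum_power_fact_le_exp[of "cmod z * \<bar>t\<bar>" n] by (simp add: mult.commute)
    have s_bnd: "cmod (s n t) \<le> cmod (g t) * exp (cmod z * \<bar>t\<bar>)" for n t
    proof -
      have "cmod (s n t) \<le> (\<Sum>i<n. cmod (g t) * ((\<bar>t\<bar> * cmod z) ^ i / fact i))"
        unfolding s_def by (rule order_trans[OF norm_sum]) (simp add: norm_mult norm_divide norm_power)
      also have "\<dots> = cmod (g t) * (\<Sum>i<n. (\<bar>t\<bar> * cmod z) ^ i / fact i)"
        by (simp add: sum_distrib_left)
      also have "\<dots> \<le> cmod (g t) * exp (cmod z * \<bar>t\<bar>)"
        by (intro mult_left_mono bnd) simp
      finally show ?thesis .
    qed
    have lim: "(\<lambda>n. s n t) \<longlonglongrightarrow> g t * exp (of_real t * z)" for t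
    proof -
      have "(\<lambda>i. g t * ((of_real t * z) ^ i / fact i)) sums (g t * exp (of_real t * z))"
        using exp_converges[of "of_real t * z"]
        by (intro sums_mult) (simp add: scaleR_conv_of_real divide_inverse mult.commute)
      then show ?thesis
        unfolding s_def sums_def .
    qed
    have "(\<lambda>n. \<integral>t. s n t \<partial>lborel) \<longlonglongrightarrow> (\<integral>t. g t * exp (of_real t * z) \<partial>lborel)"
    proof (rule integral_dominated_convergence[OF _ _ int[of "cmod z"]])
      show "AE t in lborel. (\<lambda>n. s n t) \<longlonglongrightarrow> g t * exp (of_real t * z)"
        using lim by simp
      show "AE t in lborel. norm (s n t) \<le> cmod (g t) * exp (cmod z * \<bar>t\<bar>)" for n
        using s_bnd by simp
    qed measurable
    moreover have "(\<integral>t. s n t \<partial>lborel) = (\<Sum>i<n. c i * z ^ i)" for n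
    proof -
      \<comment> \<open>A single term of the exponential series at \<open>\<bar>t\<bar>\<close> is
        at most \<open>exp \<bar>t\<bar>\<close>, so all moments exist by the case
        \<open>R = 1\<close> of \<open>int\<close>.\<close>
      have term_int: "integrable lborel (\<lambda>t. g t * of_real (t ^ i / fact i))" for i
      proof (rule Bochner_Integration.integrable_bound[OF int[of 1]])
        show "AE t in lborel. norm (g t * of_real (t ^ i / fact i)) \<le> norm (cmod (g t) * exp (1 * \<bar>t\<bar>))"
        proof (rule AE_I2)
          fix t :: real
          have "\<bar>t\<bar> ^ i / fact i \<le> (\<Sum>j<Suc i. \<bar>t\<bar> ^ j / fact j)"
            by (rule member_le_sum) auto
          also have "\<dots> \<le> exp \<bar>t\<bar>"
            by (rule sum_power_fact_le_exp) simp
          finally have "cmod (g t) * (\<bar>t\<bar> ^ i / fact i) \<le> cmod (g t) * exp \<bar>t\<bar>"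
            by (rule mult_left_mono) simp
          then show "norm (g t * of_real (t ^ i / fact i)) \<le> norm (cmod (g t) * exp (1 * \<bar>t\<bar>))"
            by (simp add: norm_mult norm_divide norm_power abs_mult)
        qed
      qed measurable
      have "s n t = (\<Sum>i<n. (g t * of_real (t ^ i / fact i)) * z ^ i)" for t
        unfolding s_def by (intro sum.cong) (simp_all add: power_mult_distrib)
      then have "(\<integral>t. s n t \<partial>lborel) = (\<integral>t. (\<Sum>i<n. (g t * of_real (t ^ i / fact i)) * z ^ i) \<partial>lborel)"
        by simp
      also have "\<dots> = (\<Sum>i<n. c i * z ^ i)"
        unfolding c_def using term_int by (subst Bochner_Integration.integral_sum) (auto intro!: sum.cong simp del: of_real_divide of_real_power)
      finally show ?thesis .
    qed
    ultimately show ?thesis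
      by (simp add: sums_def)
  qed
  have "(\<lambda>z. \<integral>t. g t * exp (of_real t * z) \<partial>lborel) = (\<lambda>z. \<Sum>n. c n * z ^ n)"
    using sums by (auto simp: sums_iff)
  then show ?thesis
    using termdiffs_strong_converges_everywhere[of c z] sums_summable[OF sums] by auto
qed

section \<open>Reduction of the transform to an integral over the real line\<close>

lemma lebesgue_integral_vec1:
  fixes k :: "real \<Rightarrow> complex"
  assumes [measurable]: "k \<in> borel_measurable borel"
  shows "(\<integral>x. k (x $ 1) \<partial>(lebesgue :: (real ^ 1) measure)) = (\<integral>t. k t \<partial>lborel)"
proof -
  have "(\<integral>x. k (x $ 1) \<partial>(lebesgue :: (real ^ 1) measure)) = (\<integral>x. k (x $ 1) \<partial>(lborel :: (real ^ 1) measure))"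
    by (rule integral_completion) measurable
  also have "\<dots> = (\<integral>t. k t \<partial>distr lborel borel (\<lambda>x :: real ^ 1. x $ 1))"
    by (rule integral_distr[symmetric]) measurable
  finally show ?thesis
    unfolding lborel_distr_component1 .
qed

text \<open>Composing a Lebesgue measurable \<open>f\<close> with a Borel map is safe only if
  preimages of null sets are null. The projection has this property because it carries
  \<open>lborel\<close> to \<open>lborel\<close>.\<close>

lemma lebesgue_measurable_component1:
  "(\<lambda>x :: real ^ 1. x $ 1) \<in> lebesgue \<rightarrow>\<^sub>M lebesgue"
proof -
  show ?thesis
  proof (rule completion.measurable_completion2)
    show "(\<lambda>x :: real ^ 1. x $ 1) \<in> lebesgue \<rightarrow>\<^sub>M lborel"
      by (rule measurable_completion) simp
    have "distr lebesgue lborel (\<lambda>x :: real ^ 1. x $ 1) = distr lborel lborel (\<lambda>x :: real ^ 1. x $ 1)"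
      by (rule distr_completion) simp
    also have "\<dots> = distr lborel borel (\<lambda>x :: real ^ 1. x $ 1)"
      by (rule distr_cong) simp_all
    finally show "null_sets lborel \<subseteq> null_sets (distr lebesgue lborel (\<lambda>x :: real ^ 1. x $ 1))"
      by (simp add: lborel_distr_component1)
  qed
qed

lemma Bargmann1_eq_lebesgue:
  "Bargmann1 \<nu> f z = of_real ((\<nu> / pi) powr (3 / 4)) *
     (\<integral>x. f (x $ 1) * exp (- of_real \<nu> * (of_real (x $ 1) - z / of_real (sqrt 2))\<^sup>2) \<partial>(lebesgue :: (real ^ 1) measure))"
  unfolding Bargmann1_def Bargmann_def csquare_def by simp

text \<open>Serves twice: it allows \<open>f\<close> to be replaced by a Borel representative, and
  it gives well-definedness of the operator on classes, as an equality of functions and not merely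
  almost everywhere.\<close>

lemma Bargmann1_cong_AE:
  assumes f: "f \<in> borel_measurable lebesgue" and g: "g \<in> borel_measurable lebesgue"
    and fg: "AE x in lebesgue. f x = g x"
  shows "Bargmann1 \<nu> f = Bargmann1 \<nu> g"
proof
  fix z
  have "AE x in distr lborel borel (\<lambda>x :: real ^ 1. x $ 1). f x = g x"
    using fg unfolding lborel_distr_component1 by (simp only: AE_completion_iff)
  then have "AE x in (lborel :: (real ^ 1) measure). f (x $ 1) = g (x $ 1)"
    by (rule AE_distrD[rotated]) measurable
  then have AE: "AE x in (lebesgue :: (real ^ 1) measure). f (x $ 1) = g (x $ 1)"
    by (rule AE_completion)
  have E: "(\<lambda>x :: real ^ 1. exp (- of_real \<nu> * (complex_of_real (x $ 1) - z / of_real (sqrt 2))\<^sup>2)) \<in> borel_measurable lebesgue"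
    by (rule measurable_completion) measurable
  have m: "(\<lambda>x :: real ^ 1. k (x $ 1) * exp (- of_real \<nu> * (complex_of_real (x $ 1) - z / of_real (sqrt 2))\<^sup>2))
      \<in> borel_measurable lebesgue" if "k \<in> borel_measurable lebesgue" for k
    using measurable_compose[OF lebesgue_measurable_component1 that] E by (rule borel_measurable_times)
  show "Bargmann1 \<nu> f z = Bargmann1 \<nu> g z"
    unfolding Bargmann1_eq_lebesgue using AE
    by (intro arg_cong2[where f = "(*)"] refl integral_cong_AE m f g) auto
qed

text \<open>Expanding the square splits off \<open>exp (- (\<nu> * z\<^sup>2 / 2))\<close> and
  leaves a two-sided Laplace transform. Holomorphy, isometry, composition and additivity all start
  from this form.\<close>

lemma Bargmann1_eq_exponential_transform:
  assumes [measurable]: "f \<in> borel_measurable borel"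
  shows "Bargmann1 \<nu> f z = of_real ((\<nu> / pi) powr (3 / 4)) * exp (- (of_real \<nu> * z\<^sup>2 / 2)) *
     (\<integral>t. (f t * of_real (exp (- (\<nu> * t\<^sup>2)))) * exp (of_real t * (of_real (sqrt 2 * \<nu>) * z)) \<partial>lborel)"
proof -
  have s2: "complex_of_real (sqrt 2) * complex_of_real (sqrt 2) = 2"
    by (simp flip: of_real_mult)
  have s2': "2 / complex_of_real (sqrt 2) = complex_of_real (sqrt 2)"
    by (simp add: s2 divide_eq_eq)
  have eq: "exp (- of_real \<nu> * (complex_of_real t - z / of_real (sqrt 2))\<^sup>2) =
      exp (- (of_real \<nu> * z\<^sup>2 / 2)) * (of_real (exp (- (\<nu> * t\<^sup>2))) * exp (of_real t * (of_real (sqrt 2 * \<nu>) * z)))" for t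
  proof -
    have "- of_real \<nu> * (complex_of_real t - z / of_real (sqrt 2))\<^sup>2 =
      - (of_real \<nu> * (z\<^sup>2 / (of_real (sqrt 2) * of_real (sqrt 2)))) + (of_real (- (\<nu> * t\<^sup>2)) + of_real t * (of_real \<nu> * (2 / of_real (sqrt 2)) * z))"
      by (simp add: power2_eq_square algebra_simps)
    also have "\<dots> = - (of_real \<nu> * z\<^sup>2 / 2) + (of_real (- (\<nu> * t\<^sup>2)) + of_real t * (of_real (sqrt 2 * \<nu>) * z))"
      unfolding s2 s2' by simp
    finally show ?thesis
      unfolding exp_of_real[symmetric] exp_add[symmetric] by simp
  qed
  have "Bargmann1 \<nu> f z = of_real ((\<nu> / pi) powr (3 / 4)) *
     (\<integral>t. f t * exp (- of_real \<nu> * (of_real t - z / of_real (sqrt 2))\<^sup>2) \<partial>lborel)"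
    unfolding Bargmann1_eq_lebesgue by (subst lebesgue_integral_vec1) simp_all
  also have "(\<integral>t. f t * exp (- of_real \<nu> * (of_real t - z / of_real (sqrt 2))\<^sup>2) \<partial>lborel) =
    (\<integral>t. exp (- (of_real \<nu> * z\<^sup>2 / 2)) * ((f t * of_real (exp (- (\<nu> * t\<^sup>2)))) * exp (of_real t * (of_real (sqrt 2 * \<nu>) * z))) \<partial>lborel)"
    unfolding eq by (simp only: mult_ac)
  finally show ?thesis
    by (simp only: integral_mult_right_zero mult.assoc)
qed

text \<open>Write the integrand as \<open>p * q\<close> with p^2 the given weighted density and
  bound it by (p^2 + q^2)/2. Then q^2 is Gaussian of rate \<open>2 * a - \<nu>\<close>, whence the
  threshold on \<open>a\<close>. It is used with \<open>a = \<nu>\<close> for the transform itself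
  and with 3\<nu>/5 for the exchange of integrals in the composition.\<close>

lemma integrable_gauss_weight:
  fixes f :: "real \<Rightarrow> complex"
  assumes [measurable]: "f \<in> borel_measurable borel"
    and f2: "integrable lborel (\<lambda>t. (cmod (f t))\<^sup>2 * exp (- (\<nu> * t\<^sup>2)))"
    and a: "\<nu> < 2 * a"
  shows "integrable lborel (\<lambda>t. cmod (f t) * exp (- (a * t\<^sup>2) + R * \<bar>t\<bar>))"
proof -
  \<comment> \<open>For either sign of \<open>t\<close> one of the two summands equals the Gaussian
    times \<open>exp (2 * R * \<bar>t\<bar>)\<close>.\<close>
  define w where "w t = exp (- ((2 * a - \<nu>) * t\<^sup>2) + (2 * R) * t) + exp (- ((2 * a - \<nu>) * t\<^sup>2) + (- 2 * R) * t)" for t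
  have "integrable lborel w"
    unfolding w_def using a by (intro Bochner_Integration.integrable_add integrable_exp_quadratic) auto
  with f2 have "integrable lborel (\<lambda>t. ((cmod (f t))\<^sup>2 * exp (- (\<nu> * t\<^sup>2)) + w t) / 2)"
    by simp
  then show ?thesis
  proof (rule Bochner_Integration.integrable_bound)
    show "AE t in lborel. norm (cmod (f t) * exp (- (a * t\<^sup>2) + R * \<bar>t\<bar>)) \<le>
        norm (((cmod (f t))\<^sup>2 * exp (- (\<nu> * t\<^sup>2)) + w t) / 2)"
    proof (rule AE_I2)
      fix t
      define p q where "p = cmod (f t) * exp (- (\<nu> * t\<^sup>2) / 2)" and "q = exp (- ((2 * a - \<nu>) * t\<^sup>2) / 2 + R * \<bar>t\<bar>)"
      have "cmod (f t) * exp (- (a * t\<^sup>2) + R * \<bar>t\<bar>) = p * q"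
        unfolding p_def q_def mult.assoc exp_add[symmetric] by (simp add: field_simps)
      also have "\<dots> \<le> (p\<^sup>2 + q\<^sup>2) / 2"
        using sum_squares_bound[of p q] by simp
      also have "p\<^sup>2 = (cmod (f t))\<^sup>2 * exp (- (\<nu> * t\<^sup>2))"
        unfolding p_def power_mult_distrib exp_double[symmetric] by simp
      also have "q\<^sup>2 = exp (- ((2 * a - \<nu>) * t\<^sup>2) + 2 * R * \<bar>t\<bar>)"
        unfolding q_def exp_double[symmetric] by (simp add: field_simps)
      also have "\<dots> \<le> w t"
        unfolding w_def by (cases "t \<ge> 0") auto
      finally have "cmod (f t) * exp (- (a * t\<^sup>2) + R * \<bar>t\<bar>) \<le> ((cmod (f t))\<^sup>2 * exp (- (\<nu> * t\<^sup>2)) + w t) / 2"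
        by simp
      moreover have "w t \<ge> 0"
        by (simp add: w_def)
      ultimately show "norm (cmod (f t) * exp (- (a * t\<^sup>2) + R * \<bar>t\<bar>)) \<le>
        norm (((cmod (f t))\<^sup>2 * exp (- (\<nu> * t\<^sup>2)) + w t) / 2)"
        by simp
    qed
  qed measurable
qed

lemma Bargmann1_has_field_derivative:
  assumes fm [measurable]: "f \<in> borel_measurable borel"
    and f2: "integrable lborel (\<lambda>t. (cmod (f t))\<^sup>2 * exp (- (\<nu> * t\<^sup>2)))" and "\<nu> > 0"
  shows "\<exists>D. (Bargmann1 \<nu> f has_field_derivative D) (at z)"
proof -
  define \<Phi> where "\<Phi> \<zeta> = (\<integral>t. (f t * of_real (exp (- (\<nu> * t\<^sup>2)))) * exp (of_real t * \<zeta>) \<partial>lborel)" for \<zeta>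
  have "integrable lborel (\<lambda>t. cmod (f t * of_real (exp (- (\<nu> * t\<^sup>2)))) * exp (R * \<bar>t\<bar>))" for R
    using integrable_gauss_weight[OF fm f2, of \<nu> R] \<open>\<nu> > 0\<close>
    by (simp only: norm_mult norm_of_real abs_exp_cancel mult.assoc exp_add)
  then have "\<exists>D. (\<Phi> has_field_derivative D) (at \<zeta>)" for \<zeta>
    unfolding \<Phi>_def by (intro entire_exponential_transform) measurable
  then obtain D where D: "(\<Phi> has_field_derivative D) (at (of_real (sqrt 2 * \<nu>) * z))"
    by blast
  have B: "Bargmann1 \<nu> f = (\<lambda>z. of_real ((\<nu> / pi) powr (3 / 4)) * exp (- (of_real \<nu> * z\<^sup>2 / 2)) * \<Phi> (of_real (sqrt 2 * \<nu>) * z))"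
    unfolding \<Phi>_def by (intro ext Bargmann1_eq_exponential_transform) measurable
  have D': "((\<lambda>z. \<Phi> (of_real (sqrt 2 * \<nu>) * z)) has_field_derivative D * of_real (sqrt 2 * \<nu>)) (at z)"
    using DERIV_chain2[where f = \<Phi> and g = "\<lambda>z. of_real (sqrt 2 * \<nu>) * z" and x = z, OF D DERIV_cmult_Id] .
  show ?thesis
    unfolding B by (rule exI) (rule derivative_eq_intros D' refl | simp)+
qed

lemma borel_measurable_Bargmann1:
  assumes "f \<in> borel_measurable borel"
    and "integrable lborel (\<lambda>t. (cmod (f t))\<^sup>2 * exp (- (\<nu> * t\<^sup>2)))" and "\<nu> > 0"
  shows "Bargmann1 \<nu> f \<in> borel_measurable borel"
proof (rule borel_measurable_continuous_onI)
  show "continuous_on UNIV (Bargmann1 \<nu> f)"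
    using Bargmann1_has_field_derivative[OF assms] DERIV_isCont
    by (intro continuous_at_imp_continuous_on) blast
qed

lemma Bargmann1_isometry:
  assumes fm [measurable]: "f \<in> borel_measurable borel"
    and f2: "integrable lborel (\<lambda>t. (cmod (f t))\<^sup>2 * exp (- (\<nu> * t\<^sup>2)))" and \<nu>: "\<nu> > 0"
  shows "(\<integral>\<^sup>+z. ennreal ((cmod (Bargmann1 \<nu> f z))\<^sup>2 * exp (- (\<nu> * (cmod z)\<^sup>2))) \<partial>lborel) =
    (\<integral>\<^sup>+t. ennreal ((cmod (f t))\<^sup>2 * exp (- (\<nu> * t\<^sup>2))) \<partial>lborel)"
proof -
  have [measurable]: "Bargmann1 \<nu> f \<in> borel_measurable borel"
    by (rule borel_measurable_Bargmann1[OF fm f2 \<nu>])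
  define C where "C = (\<nu> / pi) powr (3 / 4)"
  define c where "c = sqrt 2 * \<nu>"
  have c: "c > 0" using \<nu> by (simp add: c_def)
  define h where "h x t = f t * of_real (exp (- (\<nu> * t\<^sup>2) + c * x * t))" for x t
  have [measurable]: "(\<lambda>(x, t). h x t) \<in> borel_measurable (borel \<Otimes>\<^sub>M borel)" "h x \<in> borel_measurable borel" for x
    unfolding h_def by measurable
  have h1: "integrable lborel (h x)" for x
  proof (rule Bochner_Integration.integrable_bound)
    show "integrable lborel (\<lambda>t. cmod (f t) * exp (- (\<nu> * t\<^sup>2) + \<bar>c * x\<bar> * \<bar>t\<bar>))"
      using integrable_gauss_weight[OF fm f2, of \<nu>] \<nu> by simp
    show "AE t in lborel. norm (h x t) \<le> norm (cmod (f t) * exp (- (\<nu> * t\<^sup>2) + \<bar>c * x\<bar> * \<bar>t\<bar>))"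
    proof (rule AE_I2)
      fix t
      have "c * x * t \<le> \<bar>c * x\<bar> * \<bar>t\<bar>"
        unfolding abs_mult[symmetric] by (rule abs_ge_self)
      then have "cmod (f t) * exp (- (\<nu> * t\<^sup>2) + c * x * t) \<le> cmod (f t) * exp (- (\<nu> * t\<^sup>2) + \<bar>c * x\<bar> * \<bar>t\<bar>)"
        by (intro mult_left_mono) auto
      then show "norm (h x t) \<le> norm (cmod (f t) * exp (- (\<nu> * t\<^sup>2) + \<bar>c * x\<bar> * \<bar>t\<bar>))"
        unfolding h_def norm_mult norm_of_real abs_exp_cancel real_norm_def
        by (rule order_trans[OF _ abs_ge_self])
    qed
  qed measurable
  have hsq: "(cmod (h x t))\<^sup>2 = (cmod (f t))\<^sup>2 * exp (- (2 * \<nu> * t\<^sup>2) + 2 * c * x * t)" for x t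
    unfolding h_def norm_mult norm_of_real abs_exp_cancel power_mult_distrib exp_double[symmetric]
    by (simp add: algebra_simps)
  \<comment> \<open>The exponential growth in \<open>t\<close> uses up one of the two factors
    exp(-\<nu> t^2) in the square of \<open>h x\<close>; the other one is the weight of
    \<open>f2\<close>.\<close>
  have h2: "integrable lborel (\<lambda>t. (cmod (h x t))\<^sup>2)" for x
  proof (rule Bochner_Integration.integrable_bound)
    show "integrable lborel (\<lambda>t. exp ((c * x)\<^sup>2 / \<nu>) * ((cmod (f t))\<^sup>2 * exp (- (\<nu> * t\<^sup>2))))"
      by (rule integrable_mult_right[OF f2])
    show "AE t in lborel. norm ((cmod (h x t))\<^sup>2) \<le> norm (exp ((c * x)\<^sup>2 / \<nu>) * ((cmod (f t))\<^sup>2 * exp (- (\<nu> * t\<^sup>2))))"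
    proof (rule AE_I2)
      fix t
      have "0 \<le> \<nu> * (t - c * x / \<nu>)\<^sup>2"
        using \<nu> by simp
      also have "\<dots> = \<nu> * t\<^sup>2 - 2 * c * x * t + (c * x)\<^sup>2 / \<nu>"
        using \<nu> by (simp add: power2_eq_square field_simps)
      finally have "- (2 * \<nu> * t\<^sup>2) + 2 * c * x * t \<le> (c * x)\<^sup>2 / \<nu> + - (\<nu> * t\<^sup>2)"
        by simp
      then have "exp (- (2 * \<nu> * t\<^sup>2) + 2 * c * x * t) \<le> exp ((c * x)\<^sup>2 / \<nu>) * exp (- (\<nu> * t\<^sup>2))"
        unfolding exp_add[symmetric] by simp
      from mult_left_mono[OF this, of "(cmod (f t))\<^sup>2"]
      show "norm ((cmod (h x t))\<^sup>2) \<le> norm (exp ((c * x)\<^sup>2 / \<nu>) * ((cmod (f t))\<^sup>2 * exp (- (\<nu> * t\<^sup>2))))"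
        unfolding hsq by (simp add: mult.left_commute)
    qed
  qed measurable
  define F where "F x y = (\<integral>t. h x t * exp (\<i> * of_real (t * y)) \<partial>lborel)" for x y
  have [measurable]: "F x \<in> borel_measurable borel" for x
    unfolding F_def by measurable
  \<comment> \<open>The exponents - \<nu> (x^2 - y^2) and - \<nu> (x^2 + y^2) add up to - 2 \<nu>
    x^2, so no weight in \<open>y\<close> remains.\<close>
  have pt: "(cmod (Bargmann1 \<nu> f (Complex x y)))\<^sup>2 * exp (- (\<nu> * (cmod (Complex x y))\<^sup>2)) =
      C\<^sup>2 * exp (- (2 * \<nu> * x\<^sup>2)) * (cmod (F x (c * y)))\<^sup>2" for x y
  proof -
    define \<zeta> where "\<zeta> = complex_of_real x + \<i> * of_real y"
    have \<zeta>: "Complex x y = \<zeta>"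
      by (simp add: \<zeta>_def complex_eq_iff)
    have "of_real (exp (- (\<nu> * t\<^sup>2))) * exp (of_real t * (of_real (sqrt 2 * \<nu>) * \<zeta>)) =
        of_real (exp (- (\<nu> * t\<^sup>2) + c * x * t)) * exp (\<i> * of_real (t * (c * y)))" for t
      unfolding exp_of_real[symmetric] exp_add[symmetric] \<zeta>_def c_def by (simp add: algebra_simps)
    then have B: "Bargmann1 \<nu> f \<zeta> = of_real C * exp (- (of_real \<nu> * \<zeta>\<^sup>2 / 2)) * F x (c * y)"
      unfolding Bargmann1_eq_exponential_transform[OF fm] F_def h_def C_def by (simp only: mult.assoc)
    have "C \<ge> 0" by (simp add: C_def)
    moreover have "cmod (exp (- (of_real \<nu> * \<zeta>\<^sup>2 / 2))) = exp (- (\<nu> * (x\<^sup>2 - y\<^sup>2) / 2))"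
      unfolding norm_exp_eq_Re \<zeta>_def by (simp add: power2_eq_square)
    ultimately have "(cmod (Bargmann1 \<nu> f \<zeta>))\<^sup>2 = C\<^sup>2 * exp (- (\<nu> * (x\<^sup>2 - y\<^sup>2))) * (cmod (F x (c * y)))\<^sup>2"
      unfolding B norm_mult norm_of_real power_mult_distrib by (simp add: exp_double[symmetric])
    moreover have "exp (- (\<nu> * (x\<^sup>2 - y\<^sup>2))) * exp (- (\<nu> * (cmod (Complex x y))\<^sup>2)) = exp (- (2 * \<nu> * x\<^sup>2))"
      unfolding exp_add[symmetric] cmod_power2 by (simp add: algebra_simps)
    moreover have "K * A * L * B = K * (A * B) * L" for K A L B :: real
      by (simp only: mult_ac)
    ultimately show ?thesis
      unfolding \<zeta>[symmetric] by (simp only:)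
  qed
  \<comment> \<open>2\<pi> comes from Plancherel and 1/c from rescaling the frequency.\<close>
  have inner: "(\<integral>\<^sup>+y. ennreal ((cmod (F x (c * y)))\<^sup>2) \<partial>lborel) =
      ennreal (2 * pi / c) * (\<integral>\<^sup>+t. ennreal ((cmod (h x t))\<^sup>2) \<partial>lborel)" for x
  proof -
    define N where "N = (\<integral>t. (cmod (h x t))\<^sup>2 \<partial>lborel)"
    have N: "(\<integral>\<^sup>+t. ennreal ((cmod (h x t))\<^sup>2) \<partial>lborel) = ennreal N" "N \<ge> 0"
      unfolding N_def by (rule nn_integral_eq_integral[OF h2]) simp_all
    have "ennreal c * (\<integral>\<^sup>+y. ennreal ((cmod (F x (c * y)))\<^sup>2) \<partial>lborel) = (\<integral>\<^sup>+y. ennreal ((cmod (F x y))\<^sup>2) \<partial>lborel)"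
      using nn_integral_real_affine[of "\<lambda>y. ennreal ((cmod (F x y))\<^sup>2)" c 0] c by simp
    also have "\<dots> = ennreal (2 * pi * N)"
      unfolding F_def N_def by (rule Plancherel_L1_L2[OF _ h1 h2]) measurable
    also have "\<dots> = ennreal c * (ennreal (2 * pi / c) * ennreal N)"
      using c N(2) by (simp add: ennreal_mult[symmetric])
    finally show ?thesis
      unfolding N(1) using c by (subst (asm) ennreal_mult_cancel_left) auto
  qed
  \<comment> \<open>This is the normalisation of \<open>Bargmann1\<close> squared, times the
    Plancherel factor, times the constant of the Gaussian integral in \<open>x\<close>; the exponent
    3/4 is the one that makes the product 1.\<close>
  have const: "C\<^sup>2 * (2 * pi / c) * sqrt (pi / (2 * \<nu>)) = 1"
  proof -
    have "C\<^sup>2 = (\<nu> / pi) powr (1 + 1 / 2)"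
      unfolding C_def power2_eq_square powr_add[symmetric] by simp
    also have "\<dots> = (\<nu> / pi) * sqrt (\<nu> / pi)"
      using \<nu> unfolding powr_add by (simp add: powr_half_sqrt)
    finally have "C\<^sup>2 * (2 * pi / c) * sqrt (pi / (2 * \<nu>)) = 2 / sqrt 2 * (sqrt (\<nu> / pi) * sqrt (pi / (2 * \<nu>)))"
      using \<nu> by (simp add: c_def)
    also have "sqrt (\<nu> / pi) * sqrt (pi / (2 * \<nu>)) = sqrt (1 / 2)"
      unfolding real_sqrt_mult[symmetric] using \<nu> by simp
    also have "2 / sqrt 2 * sqrt (1 / 2) = 1"
      by (simp add: real_sqrt_divide)
    finally show ?thesis .
  qed
  have "(\<integral>\<^sup>+z. ennreal ((cmod (Bargmann1 \<nu> f z))\<^sup>2 * exp (- (\<nu> * (cmod z)\<^sup>2))) \<partial>lborel) =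
      (\<integral>\<^sup>+x. \<integral>\<^sup>+y. ennreal (C\<^sup>2 * exp (- (2 * \<nu> * x\<^sup>2))) * ennreal ((cmod (F x (c * y)))\<^sup>2) \<partial>lborel \<partial>lborel)"
    by (subst nn_integral_Complex) (simp_all add: pt ennreal_mult)
  also have "\<dots> = (\<integral>\<^sup>+x. ennreal (C\<^sup>2 * exp (- (2 * \<nu> * x\<^sup>2))) *
      (ennreal (2 * pi / c) * (\<integral>\<^sup>+t. ennreal ((cmod (h x t))\<^sup>2) \<partial>lborel)) \<partial>lborel)"
    by (simp add: nn_integral_cmult inner)
  also have "\<dots> = (\<integral>\<^sup>+x. \<integral>\<^sup>+t. ennreal (C\<^sup>2 * (2 * pi / c) * ((cmod (f t))\<^sup>2 * exp (- (2 * \<nu> * t\<^sup>2)))) *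
      ennreal (exp (- (2 * \<nu> * x\<^sup>2) + 2 * c * t * x)) \<partial>lborel \<partial>lborel)"
  proof (intro nn_integral_cong)
    fix x
    have "ennreal (C\<^sup>2 * exp (- (2 * \<nu> * x\<^sup>2))) * (ennreal (2 * pi / c) * (\<integral>\<^sup>+t. ennreal ((cmod (h x t))\<^sup>2) \<partial>lborel)) =
        (\<integral>\<^sup>+t. ennreal (C\<^sup>2 * exp (- (2 * \<nu> * x\<^sup>2))) * (ennreal (2 * pi / c) * ennreal ((cmod (h x t))\<^sup>2)) \<partial>lborel)"
      by (simp add: nn_integral_cmult)
    also have "\<dots> = (\<integral>\<^sup>+t. ennreal (C\<^sup>2 * (2 * pi / c) * ((cmod (f t))\<^sup>2 * exp (- (2 * \<nu> * t\<^sup>2)))) *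
      ennreal (exp (- (2 * \<nu> * x\<^sup>2) + 2 * c * t * x)) \<partial>lborel)"
    proof (intro nn_integral_cong)
      fix t
      have "exp (- (2 * \<nu> * x\<^sup>2)) * exp (- (2 * \<nu> * t\<^sup>2) + 2 * c * x * t) =
          exp (- (2 * \<nu> * t\<^sup>2)) * exp (- (2 * \<nu> * x\<^sup>2) + 2 * c * t * x)"
        unfolding exp_add[symmetric] by (simp add: algebra_simps)
      then have "C\<^sup>2 * exp (- (2 * \<nu> * x\<^sup>2)) * ((2 * pi / c) * (cmod (h x t))\<^sup>2) =
          C\<^sup>2 * (2 * pi / c) * ((cmod (f t))\<^sup>2 * exp (- (2 * \<nu> * t\<^sup>2))) * exp (- (2 * \<nu> * x\<^sup>2) + 2 * c * t * x)"
        unfolding hsq by (simp only: mult.assoc mult.left_commute)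
      then show "ennreal (C\<^sup>2 * exp (- (2 * \<nu> * x\<^sup>2))) * (ennreal (2 * pi / c) * ennreal ((cmod (h x t))\<^sup>2)) =
        ennreal (C\<^sup>2 * (2 * pi / c) * ((cmod (f t))\<^sup>2 * exp (- (2 * \<nu> * t\<^sup>2)))) * ennreal (exp (- (2 * \<nu> * x\<^sup>2) + 2 * c * t * x))"
        using c by (simp add: ennreal_mult[symmetric])
    qed
    finally show "ennreal (C\<^sup>2 * exp (- (2 * \<nu> * x\<^sup>2))) * (ennreal (2 * pi / c) * (\<integral>\<^sup>+t. ennreal ((cmod (h x t))\<^sup>2) \<partial>lborel)) =
      (\<integral>\<^sup>+t. ennreal (C\<^sup>2 * (2 * pi / c) * ((cmod (f t))\<^sup>2 * exp (- (2 * \<nu> * t\<^sup>2)))) *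
      ennreal (exp (- (2 * \<nu> * x\<^sup>2) + 2 * c * t * x)) \<partial>lborel)" .
  qed
  also have "\<dots> = (\<integral>\<^sup>+t. \<integral>\<^sup>+x. ennreal (C\<^sup>2 * (2 * pi / c) * ((cmod (f t))\<^sup>2 * exp (- (2 * \<nu> * t\<^sup>2)))) *
      ennreal (exp (- (2 * \<nu> * x\<^sup>2) + 2 * c * t * x)) \<partial>lborel \<partial>lborel)"
    by (rule lborel_pair.Fubini') measurable
  also have "\<dots> = (\<integral>\<^sup>+t. ennreal ((cmod (f t))\<^sup>2 * exp (- (\<nu> * t\<^sup>2))) \<partial>lborel)"
  proof (intro nn_integral_cong)
    fix t
    \<comment> \<open>As c^2 = 2 \<nu>^2, the integral over \<open>x\<close> yields exp(\<nu> t^2),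
      which reduces exp(-2 \<nu> t^2) to the weight of the norm.\<close>
    have "2 * \<nu> > 0" using \<nu> by simp
    note nn_integral_exp_quadratic[OF this, of "2 * c * t"]
    then have "(\<integral>\<^sup>+x. ennreal (exp (- (2 * \<nu> * x\<^sup>2) + 2 * c * t * x)) \<partial>lborel) = ennreal (sqrt (pi / (2 * \<nu>)) * exp (\<nu> * t\<^sup>2))"
      using \<nu> by (simp add: c_def power_mult_distrib) (simp add: power2_eq_square)
    then have "(\<integral>\<^sup>+x. ennreal (C\<^sup>2 * (2 * pi / c) * ((cmod (f t))\<^sup>2 * exp (- (2 * \<nu> * t\<^sup>2)))) *
      ennreal (exp (- (2 * \<nu> * x\<^sup>2) + 2 * c * t * x)) \<partial>lborel) =
      ennreal (C\<^sup>2 * (2 * pi / c) * ((cmod (f t))\<^sup>2 * exp (- (2 * \<nu> * t\<^sup>2)))) * ennreal (sqrt (pi / (2 * \<nu>)) * exp (\<nu> * t\<^sup>2))"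
      by (simp add: nn_integral_cmult)
    also have "\<dots> = ennreal ((C\<^sup>2 * (2 * pi / c) * ((cmod (f t))\<^sup>2 * exp (- (2 * \<nu> * t\<^sup>2)))) * (sqrt (pi / (2 * \<nu>)) * exp (\<nu> * t\<^sup>2)))"
      using c \<nu> by (intro ennreal_mult[symmetric]) simp_all
    also have "(C\<^sup>2 * (2 * pi / c) * ((cmod (f t))\<^sup>2 * exp (- (2 * \<nu> * t\<^sup>2)))) * (sqrt (pi / (2 * \<nu>)) * exp (\<nu> * t\<^sup>2)) =
       (C\<^sup>2 * (2 * pi / c) * sqrt (pi / (2 * \<nu>))) * ((cmod (f t))\<^sup>2 * (exp (- (2 * \<nu> * t\<^sup>2)) * exp (\<nu> * t\<^sup>2)))"
      by (simp only: mult_ac)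
    also have "\<dots> = (cmod (f t))\<^sup>2 * exp (- (\<nu> * t\<^sup>2))"
      unfolding const exp_add[symmetric] by simp
    finally show "(\<integral>\<^sup>+x. ennreal (C\<^sup>2 * (2 * pi / c) * ((cmod (f t))\<^sup>2 * exp (- (2 * \<nu> * t\<^sup>2)))) *
      ennreal (exp (- (2 * \<nu> * x\<^sup>2) + 2 * c * t * x)) \<partial>lborel) = ennreal ((cmod (f t))\<^sup>2 * exp (- (\<nu> * t\<^sup>2)))" .
  qed
  finally show ?thesis .
qed

subsection \<open>Composition of the transforms\<close>

text \<open>The work lies in an absolutely integrable majorant in (x, y, t): the coupling of
  \<open>t\<close> with \<open>x\<close> must be split so that Gaussian decay in \<open>x\<close>
  survives and \<open>f\<close> stays integrable against what is left in \<open>t\<close>.\<close>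

lemma Bargmann_Bargmann1:
  assumes fm [measurable]: "f \<in> borel_measurable borel"
    and f2: "integrable lborel (\<lambda>t. (cmod (f t))\<^sup>2 * exp (- (\<nu> * t\<^sup>2)))" and \<nu>: "\<nu> > 0"
  shows "Bargmann \<nu> (on_plane (Bargmann1 \<nu> f)) (vector [z, w]) =
    of_real ((\<nu> / pi) powr (1 / 2)) * Bargmann1 \<nu> f ((z + \<i> * w) / of_real (sqrt 2))"
proof -
  define a b where "a = z / of_real (sqrt 2)" and "b = w / of_real (sqrt 2)"
  have ab: "(z + \<i> * w) / of_real (sqrt 2) = a + \<i> * b"
    by (simp add: a_def b_def add_divide_distrib)
  define c where "c = complex_of_real ((\<nu> / pi) powr (3 / 4))"
  define g where "g t = f t * of_real (exp (- (\<nu> * t\<^sup>2)))" for t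
  have [measurable]: "g \<in> borel_measurable borel"
    unfolding g_def by measurable
  define s :: "real \<Rightarrow> complex" where "s t = of_real (sqrt 2 * t)" for t
  have [measurable]: "s \<in> borel_measurable borel"
    unfolding s_def by measurable
  \<comment> \<open>\<open>E\<close> collects the exponents of both kernels except - \<nu> (a^2 +
    b^2) and - \<nu> t^2; the latter is part of \<open>g\<close>.\<close>
  define E where "E x y t = - (of_real (3 * \<nu> / 2) * (of_real x)\<^sup>2) + of_real \<nu> * (s t + 2 * a) * of_real x
        + (- (of_real (\<nu> / 2) * (of_real y)\<^sup>2) + of_real \<nu> * (2 * b + \<i> * (s t - of_real x)) * of_real y)" for x y t
  have [measurable]: "Bargmann1 \<nu> f \<in> borel_measurable borel"
    by (rule borel_measurable_Bargmann1[OF fm f2 \<nu>])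
  have [measurable]: "(\<lambda>p :: real ^ 2. Complex (p $ 1) (p $ 2)) \<in> borel_measurable borel"
  proof -
    have "(\<lambda>p :: real ^ 2. Complex (p $ 1) (p $ 2)) = (\<lambda>p. of_real (p $ 1) + \<i> * of_real (p $ 2))"
      by (auto simp: complex_eq_iff)
    then show ?thesis by (elim ssubst) measurable
  qed
  have "Bargmann \<nu> (on_plane (Bargmann1 \<nu> f)) (vector [z, w]) =
    of_real ((\<nu> / pi) powr (3 / 2)) * (\<integral>p. Bargmann1 \<nu> f (Complex (p $ 1) (p $ 2)) *
      exp (- of_real \<nu> * ((of_real (p $ 1) - a)\<^sup>2 + (of_real (p $ 2) - b)\<^sup>2)) \<partial>(lebesgue :: (real ^ 2) measure))"
    unfolding Bargmann_def on_plane_def csquare_def a_def b_def by (simp add: sum_2)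
  also have "\<dots> = of_real ((\<nu> / pi) powr (3 / 2)) * (\<integral>(x, y). Bargmann1 \<nu> f (Complex x y) *
      exp (- of_real \<nu> * ((of_real x - a)\<^sup>2 + (of_real y - b)\<^sup>2)) \<partial>(lborel \<Otimes>\<^sub>M lborel))"
    by (subst lebesgue_integral_vector2) simp_all
  also have "(\<lambda>(x, y). Bargmann1 \<nu> f (Complex x y) * exp (- of_real \<nu> * ((of_real x - a)\<^sup>2 + (of_real y - b)\<^sup>2))) =
      (\<lambda>(x, y). c * exp (- (of_real \<nu> * (a\<^sup>2 + b\<^sup>2))) * (\<integral>t. g t * exp (E x y t) \<partial>lborel))"
  proof (intro ext, clarify)
    fix x y :: real
    define \<zeta> where "\<zeta> = complex_of_real x + \<i> * of_real y"
    have \<zeta>: "Complex x y = \<zeta>"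
      by (simp add: \<zeta>_def complex_eq_iff)
    define Q where "Q = - of_real \<nu> * ((of_real x - a)\<^sup>2 + (of_real y - b)\<^sup>2)"
    have expo: "exp Q * exp (- (of_real \<nu> * \<zeta>\<^sup>2 / 2)) * (g t * exp (of_real t * (of_real (sqrt 2 * \<nu>) * \<zeta>))) =
        exp (- (of_real \<nu> * (a\<^sup>2 + b\<^sup>2))) * (g t * exp (E x y t))" for t
    proof -
      have "Q + - (of_real \<nu> * \<zeta>\<^sup>2 / 2) + of_real t * (of_real (sqrt 2 * \<nu>) * \<zeta>) =
          - (of_real \<nu> * (a\<^sup>2 + b\<^sup>2)) + E x y t"
        unfolding Q_def \<zeta>_def E_def s_def
        by (simp add: power2_eq_square algebra_simps add_divide_distrib diff_divide_distrib)
      then have "exp Q * exp (- (of_real \<nu> * \<zeta>\<^sup>2 / 2)) * exp (of_real t * (of_real (sqrt 2 * \<nu>) * \<zeta>)) =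
          exp (- (of_real \<nu> * (a\<^sup>2 + b\<^sup>2))) * exp (E x y t)"
        by (simp only: exp_add[symmetric])
      moreover have "A * B * (C * D) = C * (A * B * D)" "A * (C * D) = C * (A * D)" for A B C D :: complex
        by (simp_all only: mult_ac)
      ultimately show ?thesis
        by (simp only:)
    qed
    have "Bargmann1 \<nu> f \<zeta> * exp Q =
        c * (\<integral>t. exp Q * exp (- (of_real \<nu> * \<zeta>\<^sup>2 / 2)) * (g t * exp (of_real t * (of_real (sqrt 2 * \<nu>) * \<zeta>))) \<partial>lborel)"
      unfolding Bargmann1_eq_exponential_transform[OF fm] integral_mult_right_zero c_def g_def
      by (simp only: mult_ac)
    then have "Bargmann1 \<nu> f \<zeta> * exp Q =
        c * (\<integral>t. exp (- (of_real \<nu> * (a\<^sup>2 + b\<^sup>2))) * (g t * exp (E x y t)) \<partial>lborel)"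
      by (simp only: expo)
    then show "Bargmann1 \<nu> f (Complex x y) * exp (- of_real \<nu> * ((of_real x - a)\<^sup>2 + (of_real y - b)\<^sup>2)) =
        c * exp (- (of_real \<nu> * (a\<^sup>2 + b\<^sup>2))) * (\<integral>t. g t * exp (E x y t) \<partial>lborel)"
      unfolding integral_mult_right_zero \<zeta> Q_def by (simp only: mult.assoc)
  qed
  finally have step1: "Bargmann \<nu> (on_plane (Bargmann1 \<nu> f)) (vector [z, w]) =
      of_real ((\<nu> / pi) powr (3 / 2)) * (c * exp (- (of_real \<nu> * (a\<^sup>2 + b\<^sup>2))) *
        (\<integral>(x, y). (\<integral>t. g t * exp (E x y t) \<partial>lborel) \<partial>(lborel \<Otimes>\<^sub>M lborel)))"
    by (simp only: case_prod_unfold integral_mult_right_zero)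
  define X Y :: "real \<times> real \<Rightarrow> real" where "X = fst" and "Y = snd"
  have [measurable]: "X \<in> borel_measurable borel" "Y \<in> borel_measurable borel"
    unfolding X_def Y_def by (intro borel_measurable_continuous_onI continuous_intros)+
  define W1 W2 where "W1 x = exp (- (\<nu> / 4 * x\<^sup>2) + 2 * \<nu> * Re a * x)"
    and "W2 y = exp (- (\<nu> / 2 * y\<^sup>2) + 2 * \<nu> * Re b * y)" for x y
  have Ebnd: "cmod (exp (E x y t)) \<le> exp (2 / 5 * \<nu> * t\<^sup>2) * (W1 x * W2 y)" for x y t
  proof -
    have "Re (E x y t) = - (3 * \<nu> / 2 * x\<^sup>2) + \<nu> * (sqrt 2 * t + 2 * Re a) * x - \<nu> / 2 * y\<^sup>2 + 2 * \<nu> * Re b * y"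
      unfolding E_def s_def by (simp add: power2_eq_square algebra_simps)
    \<comment> \<open>Only this real cross term has to be split, those with \<open>y\<close> being
      imaginary. The weight 5/4 stays below 3/2, leaving \<nu>/4 of decay in \<open>x\<close>; the
      weight 2/5 stays below 1/2, so the remaining rate 3\<nu>/5 in \<open>t\<close> exceeds the
      \<nu>/2 that \<open>integrable_gauss_weight\<close> requires.\<close>
    moreover have "\<nu> * (sqrt 2 * t * x) \<le> \<nu> * (2 / 5 * t\<^sup>2 + 5 / 4 * x\<^sup>2)"
    proof (rule mult_left_mono)
      have "0 \<le> 2 / 5 * (t - 5 * sqrt 2 / 4 * x)\<^sup>2"
        by simp
      also have "\<dots> = 2 / 5 * t\<^sup>2 + 5 / 4 * x\<^sup>2 - sqrt 2 * t * x"
        by (simp add: power2_diff power_mult_distrib field_simps)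
      finally show "sqrt 2 * t * x \<le> 2 / 5 * t\<^sup>2 + 5 / 4 * x\<^sup>2"
        by simp
    qed (use \<nu> in simp)
    ultimately have "Re (E x y t) \<le> 2 / 5 * \<nu> * t\<^sup>2 + ((- (\<nu> / 4 * x\<^sup>2) + 2 * \<nu> * Re a * x) + (- (\<nu> / 2 * y\<^sup>2) + 2 * \<nu> * Re b * y))"
      by (simp add: algebra_simps)
    then show ?thesis
      unfolding W1_def W2_def exp_add[symmetric] norm_exp_eq_Re by simp
  qed
  have Wi: "integrable lborel (\<lambda>p. W1 (X p) * W2 (Y p))"
  proof -
    have "integrable lborel W1" "integrable lborel W2"
      unfolding W1_def W2_def using \<nu> by (intro integrable_exp_quadratic; simp)+
    from lborel_pair.integrable_product_mult[OF this] show ?thesis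
      by (simp only: lborel_prod X_def Y_def case_prod_unfold)
  qed
  have Fi: "integrable lborel (\<lambda>t. cmod (f t) * exp (- (3 / 5 * \<nu> * t\<^sup>2)))"
    using integrable_gauss_weight[OF fm f2, of "3 / 5 * \<nu>" 0] \<nu> by simp
  have [measurable]: "(\<lambda>(p, t). exp (E (X p) (Y p) t)) \<in> borel_measurable (borel \<Otimes>\<^sub>M borel)"
    unfolding E_def by measurable
  have \<Phi>: "integrable (lborel \<Otimes>\<^sub>M lborel) (\<lambda>(p, t). g t * exp (E (X p) (Y p) t))"
  proof (rule Bochner_Integration.integrable_bound[OF lborel_pair.integrable_product_mult[OF Wi Fi]])
    show "AE q in lborel \<Otimes>\<^sub>M lborel. norm (case q of (p, t) \<Rightarrow> g t * exp (E (X p) (Y p) t)) \<le>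
       norm (case q of (p, t) \<Rightarrow> W1 (X p) * W2 (Y p) * (cmod (f t) * exp (- (3 / 5 * \<nu> * t\<^sup>2))))"
    proof (rule AE_I2, clarify)
      fix p t
      have "exp (- (\<nu> * t\<^sup>2)) * exp (2 / 5 * \<nu> * t\<^sup>2) = exp (- (3 / 5 * \<nu> * t\<^sup>2))"
        unfolding exp_add[symmetric] by simp
      moreover have "A * B * (C * D) = D * (A * (B * C))" for A B C D :: real
        by (simp only: mult_ac)
      moreover have "norm (g t * exp (E (X p) (Y p) t)) \<le> cmod (f t) * exp (- (\<nu> * t\<^sup>2)) * (exp (2 / 5 * \<nu> * t\<^sup>2) * (W1 (X p) * W2 (Y p)))"
        unfolding g_def norm_mult norm_of_real abs_exp_cancel by (rule mult_left_mono[OF Ebnd[unfolded norm_mult]]) simp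
      ultimately have "norm (g t * exp (E (X p) (Y p) t)) \<le> W1 (X p) * W2 (Y p) * (cmod (f t) * exp (- (3 / 5 * \<nu> * t\<^sup>2)))"
        by (simp only:)
      then show "norm (g t * exp (E (X p) (Y p) t)) \<le> norm (W1 (X p) * W2 (Y p) * (cmod (f t) * exp (- (3 / 5 * \<nu> * t\<^sup>2))))"
        unfolding real_norm_def by (rule order_trans[OF _ abs_ge_self])
    qed
  qed measurable
  have inner: "(\<integral>p. exp (E (X p) (Y p) t) \<partial>lborel) =
      of_real (pi / \<nu>) * exp (of_real \<nu> * (s t * (a + \<i> * b) + a\<^sup>2 / 2 - \<i> * a * b + 3 * b\<^sup>2 / 2))" for t
  proof -
    have [measurable]: "(\<lambda>p. exp (E (X p) (Y p) t)) \<in> borel_measurable borel"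
      unfolding E_def by measurable
    have "integrable lborel (\<lambda>p. exp (2 / 5 * \<nu> * t\<^sup>2) * (W1 (X p) * W2 (Y p)))"
      using Wi by (rule integrable_mult_right)
    then have "integrable lborel (\<lambda>p. exp (E (X p) (Y p) t))"
    proof (rule Bochner_Integration.integrable_bound)
      show "AE p in lborel. norm (exp (E (X p) (Y p) t)) \<le> norm (exp (2 / 5 * \<nu> * t\<^sup>2) * (W1 (X p) * W2 (Y p)))"
        unfolding real_norm_def by (intro AE_I2 order_trans[OF Ebnd abs_ge_self])
    qed measurable
    moreover have "(\<lambda>p. exp (E (X p) (Y p) t)) = (\<lambda>(x, y). exp (E x y t))"
      by (auto simp: X_def Y_def)
    ultimately have "(\<integral>x. (\<integral>y. exp (E x y t) \<partial>lborel) \<partial>lborel) = (\<integral>p. exp (E (X p) (Y p) t) \<partial>lborel)"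
      using lborel_pair.integral_fst[of "\<lambda>x y. exp (E x y t)"] by (simp only: lborel_prod)
    then show ?thesis
      using two_dimensional_complex_gaussian[OF \<nu>, of "s t" a b] unfolding E_def by simp
  qed
  \<comment> \<open>\<open>k\<close> is the part of the Gaussian value free of \<open>t\<close>.
    Together with - \<nu> (a^2 + b^2) it gives - \<nu> (a + i b)^2 / 2, the prefactor exponent of
    \<open>Bargmann1\<close> at \<open>a + \<i> * b\<close>.\<close>
  define k where "k = of_real \<nu> * (a\<^sup>2 / 2 - \<i> * a * b + 3 * b\<^sup>2 / 2)"
  have "(\<integral>(x, y). (\<integral>t. g t * exp (E x y t) \<partial>lborel) \<partial>(lborel \<Otimes>\<^sub>M lborel)) =
      (\<integral>p. (\<integral>t. g t * exp (E (X p) (Y p) t) \<partial>lborel) \<partial>lborel)"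
    by (simp only: lborel_prod X_def Y_def case_prod_unfold)
  also have "\<dots> = (\<integral>t. (\<integral>p. g t * exp (E (X p) (Y p) t) \<partial>lborel) \<partial>lborel)"
    by (rule lborel_pair.Fubini_integral[OF \<Phi>, symmetric])
  also have "\<dots> = (\<integral>t. of_real (pi / \<nu>) * exp k * (g t * exp (of_real t * (of_real (sqrt 2 * \<nu>) * (a + \<i> * b)))) \<partial>lborel)"
  proof -
    have "of_real \<nu> * (s t * (a + \<i> * b) + a\<^sup>2 / 2 - \<i> * a * b + 3 * b\<^sup>2 / 2) =
        k + of_real t * (of_real (sqrt 2 * \<nu>) * (a + \<i> * b))" for t
      unfolding k_def s_def by (simp add: algebra_simps)
    then show ?thesis
      by (simp only: integral_mult_right_zero inner exp_add mult_ac)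
  qed
  finally have step2: "(\<integral>(x, y). (\<integral>t. g t * exp (E x y t) \<partial>lborel) \<partial>(lborel \<Otimes>\<^sub>M lborel)) =
      of_real (pi / \<nu>) * exp k * (\<integral>t. g t * exp (of_real t * (of_real (sqrt 2 * \<nu>) * (a + \<i> * b))) \<partial>lborel)"
    by (simp only: integral_mult_right_zero)
  have const: "(\<nu> / pi) powr (3 / 2) * (pi / \<nu>) = (\<nu> / pi) powr (1 / 2)"
  proof -
    have "(\<nu> / pi) powr (3 / 2) = (\<nu> / pi) powr (1 / 2) * (\<nu> / pi) powr 1"
      unfolding powr_add[symmetric] by simp
    then show ?thesis using \<nu> by simp
  qed
  have "- (of_real \<nu> * (a\<^sup>2 + b\<^sup>2)) + k = - (of_real \<nu> * (a + \<i> * b)\<^sup>2 / 2)"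
    unfolding k_def by (simp add: power2_eq_square algebra_simps add_divide_distrib diff_divide_distrib)
  then have ek: "exp (- (of_real \<nu> * (a\<^sup>2 + b\<^sup>2))) * exp k = exp (- (of_real \<nu> * (a + \<i> * b)\<^sup>2 / 2))"
    by (simp only: exp_add[symmetric])
  define J where "J = (\<integral>t. g t * exp (of_real t * (of_real (sqrt 2 * \<nu>) * (a + \<i> * b))) \<partial>lborel)"
  have B: "Bargmann1 \<nu> f (a + \<i> * b) = c * (exp (- (of_real \<nu> * (a\<^sup>2 + b\<^sup>2))) * exp k) * J"
    unfolding Bargmann1_eq_exponential_transform[OF fm] c_def g_def J_def ek by (rule refl)
  have "of_real ((\<nu> / pi) powr (3 / 2)) * of_real (pi / \<nu>) = complex_of_real ((\<nu> / pi) powr (1 / 2))"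
    by (simp only: const of_real_mult[symmetric])
  moreover have "A1 * (A2 * A3 * (A4 * A5 * A6)) = A1 * A4 * (A2 * (A3 * A5) * A6)" for A1 A2 A3 A4 A5 A6 :: complex
    by (simp only: mult_ac)
  ultimately show ?thesis
    unfolding step1 step2[folded J_def] ab B by (simp only:)
qed

subsection \<open>The isometry into the Bargmann-Fock space\<close>

lemma borel_measurable_gauss_measure: "borel_measurable (gauss_measure \<nu>) = borel_measurable lebesgue"
  by (rule measurable_cong_sets) (simp_all add: gauss_measure_def)

lemma borel_measurable_gauss_weight [measurable]:
  "(\<lambda>x :: 'a::euclidean_space. exp (- (\<nu> * (norm x)\<^sup>2))) \<in> borel_measurable lebesgue"
  by (rule measurable_completion) measurable

text \<open>The density is strictly positive, so both measures have the same null sets.\<close>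

lemma AE_gauss_measure_iff:
  "(AE x in (gauss_measure \<nu> :: 'a::euclidean_space measure). P x) \<longleftrightarrow> (AE x in lebesgue. P x)"
  unfolding gauss_measure_def by (subst AE_density) auto

lemma nn_integral_gauss_measure:
  fixes f :: "'a::euclidean_space \<Rightarrow> complex"
  assumes [measurable]: "f \<in> borel_measurable lebesgue"
  shows "(\<integral>\<^sup>+x. ennreal ((cmod (f x))\<^sup>2) \<partial>gauss_measure \<nu>) =
    (\<integral>\<^sup>+x. ennreal ((cmod (f x))\<^sup>2 * exp (- (\<nu> * (norm x)\<^sup>2))) \<partial>lborel)"
  unfolding gauss_measure_def
  by (subst nn_integral_density) (auto simp: nn_integral_completion ennreal_mult mult.commute)

lemma gauss_L2_iff:
  fixes f :: "'a::euclidean_space \<Rightarrow> complex"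
  shows "f \<in> gauss_L2 \<nu> \<longleftrightarrow> f \<in> borel_measurable lebesgue \<and>
    (\<integral>\<^sup>+x. ennreal ((cmod (f x))\<^sup>2 * exp (- (\<nu> * (norm x)\<^sup>2))) \<partial>lborel) < \<infinity>"
proof (cases "f \<in> borel_measurable lebesgue")
  case True
  then have "(\<lambda>x. (cmod (f x))\<^sup>2) \<in> borel_measurable (gauss_measure \<nu>)"
    unfolding borel_measurable_gauss_measure by measurable
  then show ?thesis
    using True by (simp add: gauss_L2_def borel_measurable_gauss_measure integrable_iff_bounded nn_integral_gauss_measure)
qed (simp add: gauss_L2_def borel_measurable_gauss_measure)

text \<open>For an infinite integral both sides are 0: the Bochner integral defaults to 0, and
  \<open>enn2real\<close> sends infinity to 0.\<close>

lemma gauss_norm_eq: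
  fixes f :: "'a::euclidean_space \<Rightarrow> complex"
  assumes f: "f \<in> borel_measurable lebesgue"
  shows "gauss_norm \<nu> f =
    sqrt (enn2real (\<integral>\<^sup>+x. ennreal ((cmod (f x))\<^sup>2 * exp (- (\<nu> * (norm x)\<^sup>2))) \<partial>lborel))"
proof -
  have m: "(\<lambda>x. (cmod (f x))\<^sup>2) \<in> borel_measurable (gauss_measure \<nu>)"
    unfolding borel_measurable_gauss_measure using f by measurable
  have "gauss_inner \<nu> f f = of_real (\<integral>x. (cmod (f x))\<^sup>2 \<partial>gauss_measure \<nu>)"
    unfolding gauss_inner_def complex_norm_square[symmetric] of_real_power[symmetric] by (rule integral_complex_of_real)
  then show ?thesis
    unfolding gauss_norm_def using m
    by (simp add: integral_eq_nn_integral nn_integral_gauss_measure[OF f])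
qed

lemma lebesgue_measurable_ex_borel:
  fixes f :: "'a::euclidean_space \<Rightarrow> complex"
  assumes "f \<in> borel_measurable lebesgue"
  obtains g where "g \<in> borel_measurable borel" "AE x in lborel. f x = g x"
proof -
  have "(\<lambda>x. Re (f x)) \<in> borel_measurable lebesgue" "(\<lambda>x. Im (f x)) \<in> borel_measurable lebesgue"
    using assms by measurable
  from this[THEN completion_ex_borel_measurable_real]
  obtain u v where [measurable]: "u \<in> borel_measurable lborel" "v \<in> borel_measurable lborel"
    and uv: "AE x in lborel. Re (f x) = u x" "AE x in lborel. Im (f x) = v x"
    by blast
  show ?thesis
  proof
    show "(\<lambda>x. of_real (u x) + \<i> * of_real (v x)) \<in> borel_measurable borel"
      using measurable_lborel2 by measurable
    show "AE x in lborel. f x = of_real (u x) + \<i> * of_real (v x)"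
      using uv by eventually_elim (simp add: complex_eq_iff)
  qed
qed

text \<open>Supplies the representative on which all Borel statements about the transform operate,
  with the weighted integral carried over for the norm identity.\<close>

lemma gauss_L2_real_ex_borel:
  fixes f :: "real \<Rightarrow> complex"
  assumes f: "f \<in> gauss_L2 \<nu>"
  obtains g where "g \<in> borel_measurable borel" "AE x in lebesgue. f x = g x"
    "integrable lborel (\<lambda>t. (cmod (g t))\<^sup>2 * exp (- (\<nu> * t\<^sup>2)))"
    "(\<integral>\<^sup>+t. ennreal ((cmod (g t))\<^sup>2 * exp (- (\<nu> * t\<^sup>2))) \<partial>lborel) =
     (\<integral>\<^sup>+t. ennreal ((cmod (f t))\<^sup>2 * exp (- (\<nu> * (norm t)\<^sup>2))) \<partial>lborel)"
proof -
  have fm: "f \<in> borel_measurable lebesgue"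
    and fin: "(\<integral>\<^sup>+t. ennreal ((cmod (f t))\<^sup>2 * exp (- (\<nu> * (norm t)\<^sup>2))) \<partial>lborel) < \<infinity>"
    using f by (simp_all add: gauss_L2_iff)
  obtain g where g [measurable]: "g \<in> borel_measurable borel" and fg: "AE x in lborel. f x = g x"
    using lebesgue_measurable_ex_borel[OF fm] .
  have eq: "(\<integral>\<^sup>+t. ennreal ((cmod (g t))\<^sup>2 * exp (- (\<nu> * t\<^sup>2))) \<partial>lborel) =
     (\<integral>\<^sup>+t. ennreal ((cmod (f t))\<^sup>2 * exp (- (\<nu> * (norm t)\<^sup>2))) \<partial>lborel)"
    by (rule nn_integral_cong_AE) (use fg in eventually_elim, simp)
  show ?thesis
  proof (rule that[OF g AE_completion[OF fg] _ eq])
    show "integrable lborel (\<lambda>t. (cmod (g t))\<^sup>2 * exp (- (\<nu> * t\<^sup>2)))"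
      using fin unfolding eq[symmetric] by (simp add: integrable_iff_bounded)
  qed
qed

lemma power2_norm_vec2:
  fixes v :: "complex ^ 2"
  shows "(norm v)\<^sup>2 = (cmod (v $ 1))\<^sup>2 + (cmod (v $ 2))\<^sup>2"
  by (simp add: norm_vec_def L2_set_def sum_2)

text \<open>In place of a determinant on \<open>complex ^ 2\<close>, the rotation is done by two
  affine substitutions: \<open>z\<close> is replaced by \<zeta> with \<open>w\<close> fixed, then
  \<open>w\<close> with \<zeta> fixed. The first brings out a Jacobian 2 and the second absorbs
  it.\<close>

lemma nn_integral_rotated_gaussian:
  fixes \<psi> :: "complex \<Rightarrow> ennreal"
  assumes [measurable]: "\<psi> \<in> borel_measurable borel" and \<nu>: "\<nu> > 0"
  shows "(\<integral>\<^sup>+v. \<psi> ((v $ 1 + \<i> * v $ 2) / of_real (sqrt 2)) * ennreal (exp (- (\<nu> * (norm v)\<^sup>2)))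
      \<partial>(lborel :: (complex ^ 2) measure)) =
    ennreal (pi / \<nu>) * (\<integral>\<^sup>+\<zeta>. \<psi> \<zeta> * ennreal (exp (- (\<nu> * (cmod \<zeta>)\<^sup>2))) \<partial>lborel)"
proof -
  define e where "e \<zeta> = ennreal (exp (- (\<nu> * (cmod \<zeta>)\<^sup>2)))" for \<zeta> :: complex
  have [measurable]: "e \<in> borel_measurable borel"
    unfolding e_def by measurable
  have e_split: "e z * e w = ennreal (exp (- (\<nu> * ((cmod z)\<^sup>2 + (cmod w)\<^sup>2))))" for z w
    unfolding e_def by (simp add: ennreal_mult[symmetric] exp_add[symmetric] algebra_simps)
  \<comment> \<open>With z = sqrt 2 \<zeta> - i w, the last term is i times (z - i w) / sqrt 2, the
    coordinate orthogonal to \<zeta>; the identity is unitarity of the rotation.\<close>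
  have rot: "(cmod (- (\<i> * w) + of_real (sqrt 2) * \<zeta>))\<^sup>2 + (cmod w)\<^sup>2 =
      (cmod \<zeta>)\<^sup>2 + (cmod (\<i> * \<zeta> + of_real (sqrt 2) * w))\<^sup>2" for w \<zeta>
  proof -
    have s: "sqrt 2 * (sqrt 2 * X) = 2 * X" for X :: real
      by (simp flip: mult.assoc)
    show ?thesis
      unfolding cmod_power2 by (simp add: power2_eq_square algebra_simps s)
  qed
  have "(\<integral>\<^sup>+v. \<psi> ((v $ 1 + \<i> * v $ 2) / of_real (sqrt 2)) * ennreal (exp (- (\<nu> * (norm v)\<^sup>2)))
      \<partial>(lborel :: (complex ^ 2) measure)) =
      (\<integral>\<^sup>+w. \<integral>\<^sup>+z. \<psi> ((z + \<i> * w) / of_real (sqrt 2)) * (e z * e w) \<partial>lborel \<partial>lborel)"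
    by (subst nn_integral_vector2) (simp_all add: power2_norm_vec2 e_split)
  also have "\<dots> = (\<integral>\<^sup>+w. \<integral>\<^sup>+\<zeta>. 2 * (\<psi> \<zeta> * (e \<zeta> * e (\<i> * \<zeta> + of_real (sqrt 2) * w))) \<partial>lborel \<partial>lborel)"
  proof (rule nn_integral_cong)
    fix w :: complex
    have "(\<integral>\<^sup>+z. \<psi> ((z + \<i> * w) / of_real (sqrt 2)) * (e z * e w) \<partial>lborel) =
        2 * (\<integral>\<^sup>+\<zeta>. \<psi> ((- (\<i> * w) + of_real (sqrt 2) * \<zeta> + \<i> * w) / of_real (sqrt 2)) *
          (e (- (\<i> * w) + of_real (sqrt 2) * \<zeta>) * e w) \<partial>lborel)"
      by (rule nn_integral_complex_affine) measurable
    also have "\<dots> = 2 * (\<integral>\<^sup>+\<zeta>. \<psi> \<zeta> * (e \<zeta> * e (\<i> * \<zeta> + of_real (sqrt 2) * w)) \<partial>lborel)"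
      unfolding e_split rot by simp
    finally show "(\<integral>\<^sup>+z. \<psi> ((z + \<i> * w) / of_real (sqrt 2)) * (e z * e w) \<partial>lborel) =
        (\<integral>\<^sup>+\<zeta>. 2 * (\<psi> \<zeta> * (e \<zeta> * e (\<i> * \<zeta> + of_real (sqrt 2) * w))) \<partial>lborel)"
      by (simp add: nn_integral_cmult)
  qed
  also have "\<dots> = (\<integral>\<^sup>+\<zeta>. \<integral>\<^sup>+w. 2 * (\<psi> \<zeta> * (e \<zeta> * e (\<i> * \<zeta> + of_real (sqrt 2) * w))) \<partial>lborel \<partial>lborel)"
    by (rule lborel_pair.Fubini') measurable
  also have "\<dots> = (\<integral>\<^sup>+\<zeta>. ennreal (pi / \<nu>) * (\<psi> \<zeta> * e \<zeta>) \<partial>lborel)"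
  proof (intro nn_integral_cong)
    fix \<zeta> :: complex
    have "2 * (\<integral>\<^sup>+w. e (\<i> * \<zeta> + of_real (sqrt 2) * w) \<partial>lborel) = (\<integral>\<^sup>+z. e z \<partial>lborel)"
      by (rule nn_integral_complex_affine[symmetric]) measurable
    also have "\<dots> = ennreal (pi / \<nu>)"
      unfolding e_def by (rule nn_integral_complex_gaussian[OF \<nu>])
    finally have g: "2 * (\<integral>\<^sup>+w. e (\<i> * \<zeta> + of_real (sqrt 2) * w) \<partial>lborel) = ennreal (pi / \<nu>)" .
    have "(\<integral>\<^sup>+w. 2 * (\<psi> \<zeta> * (e \<zeta> * e (\<i> * \<zeta> + of_real (sqrt 2) * w))) \<partial>lborel) =
        (\<psi> \<zeta> * e \<zeta>) * (2 * (\<integral>\<^sup>+w. e (\<i> * \<zeta> + of_real (sqrt 2) * w) \<partial>lborel))"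
      by (simp add: nn_integral_cmult mult_ac)
    then show "(\<integral>\<^sup>+w. 2 * (\<psi> \<zeta> * (e \<zeta> * e (\<i> * \<zeta> + of_real (sqrt 2) * w))) \<partial>lborel) = ennreal (pi / \<nu>) * (\<psi> \<zeta> * e \<zeta>)"
      unfolding g by (simp only: mult.commute)
  qed
  also have "\<dots> = ennreal (pi / \<nu>) * (\<integral>\<^sup>+\<zeta>. \<psi> \<zeta> * e \<zeta> \<partial>lborel)"
    by (rule nn_integral_cmult) measurable
  finally show ?thesis
    unfolding e_def .
qed

lemma borel_measurable_G_transform:
  assumes "f \<in> borel_measurable borel"
    and "integrable lborel (\<lambda>t. (cmod (f t))\<^sup>2 * exp (- (\<nu> * t\<^sup>2)))" and "\<nu> > 0"
  shows "G_transform \<nu> f \<in> borel_measurable borel"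
proof -
  have [measurable]: "Bargmann1 \<nu> f \<in> borel_measurable borel"
    by (rule borel_measurable_Bargmann1[OF assms])
  show ?thesis
    unfolding G_transform_def[abs_def] by measurable
qed

lemma G_transform_isometry:
  assumes fm: "f \<in> borel_measurable borel"
    and f2: "integrable lborel (\<lambda>t. (cmod (f t))\<^sup>2 * exp (- (\<nu> * t\<^sup>2)))" and \<nu>: "\<nu> > 0"
  shows "(\<integral>\<^sup>+v. ennreal ((cmod (G_transform \<nu> f v))\<^sup>2 * exp (- (\<nu> * (norm v)\<^sup>2))) \<partial>lborel) =
    (\<integral>\<^sup>+t. ennreal ((cmod (f t))\<^sup>2 * exp (- (\<nu> * t\<^sup>2))) \<partial>lborel)"
proof -
  have [measurable]: "Bargmann1 \<nu> f \<in> borel_measurable borel"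
    by (rule borel_measurable_Bargmann1[OF assms])
  define \<psi> where "\<psi> \<zeta> = ennreal ((cmod (Bargmann1 \<nu> f \<zeta>))\<^sup>2)" for \<zeta>
  have [measurable]: "\<psi> \<in> borel_measurable borel"
    unfolding \<psi>_def by measurable
  have "((\<nu> / pi) powr (1 / 2))\<^sup>2 = \<nu> / pi"
    using \<nu> by (simp add: powr_half_sqrt)
  then have "(cmod (G_transform \<nu> f v))\<^sup>2 * exp (- (\<nu> * (norm v)\<^sup>2)) =
      (\<nu> / pi) * ((cmod (Bargmann1 \<nu> f ((v $ 1 + \<i> * v $ 2) / of_real (sqrt 2))))\<^sup>2 * exp (- (\<nu> * (norm v)\<^sup>2)))" for v
    unfolding G_transform_def norm_mult norm_of_real power_mult_distrib power2_abs by (simp only: mult.assoc)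
  moreover have "ennreal (\<nu> / pi * (x\<^sup>2 * exp y)) = ennreal (\<nu> / pi) * (ennreal (x\<^sup>2) * ennreal (exp y))" for x y
    using \<nu> by (subst ennreal_mult) (simp_all add: ennreal_mult)
  ultimately have pt: "ennreal ((cmod (G_transform \<nu> f v))\<^sup>2 * exp (- (\<nu> * (norm v)\<^sup>2))) =
      ennreal (\<nu> / pi) * (\<psi> ((v $ 1 + \<i> * v $ 2) / of_real (sqrt 2)) * ennreal (exp (- (\<nu> * (norm v)\<^sup>2))))" for v
    unfolding \<psi>_def by (simp only:)
  have "(\<integral>\<^sup>+v. ennreal ((cmod (G_transform \<nu> f v))\<^sup>2 * exp (- (\<nu> * (norm v)\<^sup>2))) \<partial>lborel) =
      ennreal (\<nu> / pi) * (ennreal (pi / \<nu>) * (\<integral>\<^sup>+\<zeta>. \<psi> \<zeta> * ennreal (exp (- (\<nu> * (cmod \<zeta>)\<^sup>2))) \<partial>lborel))"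
    unfolding pt by (subst nn_integral_cmult) (simp_all add: nn_integral_rotated_gaussian \<nu>)
  also have "\<dots> = (ennreal (\<nu> / pi) * ennreal (pi / \<nu>)) * (\<integral>\<^sup>+\<zeta>. \<psi> \<zeta> * ennreal (exp (- (\<nu> * (cmod \<zeta>)\<^sup>2))) \<partial>lborel)"
    by (simp only: mult.assoc)
  also have "ennreal (\<nu> / pi) * ennreal (pi / \<nu>) = 1"
    using \<nu> by (simp add: ennreal_mult[symmetric])
  finally show ?thesis
    unfolding Bargmann1_isometry[OF assms, symmetric] \<psi>_def by (simp add: ennreal_mult)
qed

lemma entire_G_transform:
  assumes "f \<in> borel_measurable borel"
    and "integrable lborel (\<lambda>t. (cmod (f t))\<^sup>2 * exp (- (\<nu> * t\<^sup>2)))" and "\<nu> > 0"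
  shows "entire_fun (G_transform \<nu> f)"
  unfolding entire_fun_def
proof
  fix v :: "complex ^ 2"
  define L where "L u = (u $ 1 + \<i> * u $ 2) / of_real (sqrt 2)" for u :: "complex ^ 2"
  define k where "k = complex_of_real ((\<nu> / pi) powr (1 / 2))"
  \<comment> \<open>\<open>linear\<close> is real linearity, which yields the Frechet derivative;
    compatibility with complex scalars is checked separately on the derivative.\<close>
  have "linear L"
  proof (rule linearI)
    show "L (u + w) = L u + L w" for u w
      by (simp add: L_def algebra_simps add_divide_distrib)
    show "L (r *\<^sub>R u) = r *\<^sub>R L u" for r u
      unfolding L_def vector_scaleR_component by (simp add: scaleR_conv_of_real algebra_simps add_divide_distrib)
  qed
  then have L: "(L has_derivative L) (at v)"
    by (intro bounded_linear_imp_has_derivative) (simp add: linear_conv_bounded_linear)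
  obtain D where "(Bargmann1 \<nu> f has_field_derivative D) (at (L v))"
    using Bargmann1_has_field_derivative[OF assms] by blast
  then have "((\<lambda>u. Bargmann1 \<nu> f (L u)) has_derivative (\<lambda>h. D * L h)) (at v)"
    unfolding has_field_derivative_def by (rule has_derivative_compose[OF L])
  then have "((\<lambda>u. k * Bargmann1 \<nu> f (L u)) has_derivative (\<lambda>h. k * (D * L h))) (at v)"
    by (rule has_derivative_mult_right)
  then have "(G_transform \<nu> f has_derivative (\<lambda>h. k * (D * L h))) (at v)"
    unfolding G_transform_def[abs_def] L_def k_def .
  moreover have "k * (D * L (c *s u)) = c * (k * (D * L u))" for c u
    by (simp add: L_def algebra_simps)
  ultimately show "\<exists>D. (G_transform \<nu> f has_derivative D) (at v) \<and> (\<forall>c u. D (c *s u) = c * D u)"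
    by blast
qed

section \<open>Linearity of the transform\<close>

lemma integrable_exponential_transform:
  assumes fm [measurable]: "f \<in> borel_measurable borel"
    and f2: "integrable lborel (\<lambda>t. (cmod (f t))\<^sup>2 * exp (- (\<nu> * t\<^sup>2)))" and \<nu>: "\<nu> > 0"
  shows "integrable lborel (\<lambda>t. (f t * of_real (exp (- (\<nu> * t\<^sup>2)))) * exp (of_real t * \<zeta>))"
proof (rule Bochner_Integration.integrable_bound)
  show "integrable lborel (\<lambda>t. cmod (f t) * exp (- (\<nu> * t\<^sup>2) + cmod \<zeta> * \<bar>t\<bar>))"
    using \<nu> by (intro integrable_gauss_weight[OF fm f2]) simp
  show "AE t in lborel. norm (f t * of_real (exp (- (\<nu> * t\<^sup>2))) * exp (of_real t * \<zeta>)) \<le>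
      norm (cmod (f t) * exp (- (\<nu> * t\<^sup>2) + cmod \<zeta> * \<bar>t\<bar>))"
  proof (rule AE_I2)
    fix t :: real
    have "Re (of_real t * \<zeta>) \<le> cmod (of_real t * \<zeta>)"
      by (rule complex_Re_le_cmod)
    then have "exp (Re (of_real t * \<zeta>)) \<le> exp (cmod \<zeta> * \<bar>t\<bar>)"
      by (simp add: norm_mult mult.commute)
    then have "cmod (f t) * exp (- (\<nu> * t\<^sup>2)) * exp (Re (of_real t * \<zeta>)) \<le> cmod (f t) * exp (- (\<nu> * t\<^sup>2)) * exp (cmod \<zeta> * \<bar>t\<bar>)"
      by (rule mult_left_mono) simp
    then have "cmod (f t) * exp (- (\<nu> * t\<^sup>2)) * exp (Re (of_real t * \<zeta>)) \<le> cmod (f t) * exp (- (\<nu> * t\<^sup>2) + cmod \<zeta> * \<bar>t\<bar>)"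
      by (simp only: exp_add mult.assoc)
    then show "norm (f t * of_real (exp (- (\<nu> * t\<^sup>2))) * exp (of_real t * \<zeta>)) \<le>
      norm (cmod (f t) * exp (- (\<nu> * t\<^sup>2) + cmod \<zeta> * \<bar>t\<bar>))"
      unfolding norm_mult norm_of_real abs_exp_cancel norm_exp_eq_Re real_norm_def
      by (rule order_trans[OF _ abs_ge_self])
  qed
qed measurable

lemma Bargmann1_add:
  assumes [measurable]: "f \<in> borel_measurable borel" "g \<in> borel_measurable borel"
    and f2: "integrable lborel (\<lambda>t. (cmod (f t))\<^sup>2 * exp (- (\<nu> * t\<^sup>2)))"
    and g2: "integrable lborel (\<lambda>t. (cmod (g t))\<^sup>2 * exp (- (\<nu> * t\<^sup>2)))" and \<nu>: "\<nu> > 0"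
  shows "Bargmann1 \<nu> (\<lambda>x. f x + g x) z = Bargmann1 \<nu> f z + Bargmann1 \<nu> g z"
proof -
  have fg: "(\<lambda>x. f x + g x) \<in> borel_measurable borel"
    by measurable
  show ?thesis
    unfolding Bargmann1_eq_exponential_transform[OF fg] Bargmann1_eq_exponential_transform[OF assms(1)]
      Bargmann1_eq_exponential_transform[OF assms(2)] distrib_right distrib_left[symmetric]
    by (subst Bochner_Integration.integral_add)
      (simp_all only: integrable_exponential_transform assms)
qed

text \<open>Constants leave a Bochner integral even in the divergent case, where it is 0 by
  convention.\<close>

lemma Bargmann1_cmult: "Bargmann1 \<nu> (\<lambda>x. c * f x) z = c * Bargmann1 \<nu> f z"
  unfolding Bargmann1_eq_lebesgue mult.assoc integral_mult_right_zero by (simp only: mult.left_commute)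

theorem theorem2p1:
  fixes \<nu> :: real
  assumes "\<nu> > 0"
  shows "(\<forall>f \<in> (gauss_L2 \<nu> :: (real \<Rightarrow> complex) set). \<forall>z w :: complex.
            Bargmann \<nu> (on_plane (Bargmann1 \<nu> f)) (vector [z, w] :: complex ^ 2) =
            G_transform \<nu> f (vector [z, w]))
       \<and> isometric_operator \<nu> (G_transform \<nu>) (Fock \<nu> :: (complex ^ 2 \<Rightarrow> complex) set)"
proof
  have meas: "f \<in> borel_measurable lebesgue" if "f \<in> gauss_L2 \<nu>" for f :: "real \<Rightarrow> complex"
    using that by (simp add: gauss_L2_iff)
  have G_cong: "G_transform \<nu> f = G_transform \<nu> g"
    if "f \<in> borel_measurable lebesgue" "g \<in> borel_measurable lebesgue" "AE x in lebesgue. f x = g x" for f g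
    unfolding G_transform_def[abs_def] Bargmann1_cong_AE[OF that] by (rule refl)
  show "\<forall>f \<in> (gauss_L2 \<nu> :: (real \<Rightarrow> complex) set). \<forall>z w :: complex.
      Bargmann \<nu> (on_plane (Bargmann1 \<nu> f)) (vector [z, w] :: complex ^ 2) = G_transform \<nu> f (vector [z, w])"
  proof (intro ballI allI)
    fix f :: "real \<Rightarrow> complex" and z w :: complex
    assume f: "f \<in> gauss_L2 \<nu>"
    obtain g where g: "g \<in> borel_measurable borel" "AE x in lebesgue. f x = g x"
      "integrable lborel (\<lambda>t. (cmod (g t))\<^sup>2 * exp (- (\<nu> * t\<^sup>2)))"
      using gauss_L2_real_ex_borel[OF f] by blast
    have "Bargmann1 \<nu> f = Bargmann1 \<nu> g"
      using meas[OF f] g by (intro Bargmann1_cong_AE) (auto intro: measurable_completion)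
    then show "Bargmann \<nu> (on_plane (Bargmann1 \<nu> f)) (vector [z, w] :: complex ^ 2) = G_transform \<nu> f (vector [z, w])"
      using Bargmann_Bargmann1[OF g(1,3) assms] by (simp add: G_transform_def)
  qed
  show "isometric_operator \<nu> (G_transform \<nu>) (Fock \<nu> :: (complex ^ 2 \<Rightarrow> complex) set)"
    unfolding isometric_operator_def
  proof (intro conjI ballI allI impI)
    fix f :: "real \<Rightarrow> complex"
    assume f: "f \<in> gauss_L2 \<nu>"
    obtain g where g: "g \<in> borel_measurable borel" "AE x in lebesgue. f x = g x"
      "integrable lborel (\<lambda>t. (cmod (g t))\<^sup>2 * exp (- (\<nu> * t\<^sup>2)))"
      and eq: "(\<integral>\<^sup>+t. ennreal ((cmod (g t))\<^sup>2 * exp (- (\<nu> * t\<^sup>2))) \<partial>lborel) =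
        (\<integral>\<^sup>+t. ennreal ((cmod (f t))\<^sup>2 * exp (- (\<nu> * (norm t)\<^sup>2))) \<partial>lborel)"
      using gauss_L2_real_ex_borel[OF f] by blast
    have Gfg: "G_transform \<nu> f = G_transform \<nu> g"
      using meas[OF f] g by (intro G_cong) (auto intro: measurable_completion)
    have Gm: "G_transform \<nu> f \<in> borel_measurable lebesgue"
      unfolding Gfg using borel_measurable_G_transform[OF g(1,3) assms] by (intro measurable_completion) simp
    \<comment> \<open>One equality of extended integrals yields both finiteness of the norm of the
      image and its value.\<close>
    note iso = G_transform_isometry[OF g(1,3) assms, folded Gfg, unfolded eq]
    have "G_transform \<nu> f \<in> gauss_L2 \<nu>"
      using f Gm unfolding gauss_L2_iff iso by simp
    moreover have "entire_fun (G_transform \<nu> f)"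
      unfolding Gfg by (rule entire_G_transform[OF g(1,3) assms])
    ultimately show "G_transform \<nu> f \<in> Fock \<nu>"
      by (simp add: Fock_def)
    show "gauss_norm \<nu> (G_transform \<nu> f) = gauss_norm \<nu> f"
      unfolding gauss_norm_eq[OF Gm] gauss_norm_eq[OF meas[OF f]] iso by (rule refl)
    show "G_transform \<nu> (\<lambda>x. c * f x) = (\<lambda>z. c * G_transform \<nu> f z)" for c
      unfolding G_transform_def[abs_def] Bargmann1_cmult by (simp only: mult.left_commute)
    fix f' :: "real \<Rightarrow> complex"
    assume f': "f' \<in> gauss_L2 \<nu>"
    show "G_transform \<nu> f = G_transform \<nu> f'" if "AE x in gauss_measure \<nu>. f x = f' x"
      using that by (intro G_cong meas f f') (simp only: AE_gauss_measure_iff)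
    obtain g' where g': "g' \<in> borel_measurable borel" "AE x in lebesgue. f' x = g' x"
      "integrable lborel (\<lambda>t. (cmod (g' t))\<^sup>2 * exp (- (\<nu> * t\<^sup>2)))"
      using gauss_L2_real_ex_borel[OF f'] by blast
    have Gfg': "G_transform \<nu> f' = G_transform \<nu> g'"
      using meas[OF f'] g' by (intro G_cong) (auto intro: measurable_completion)
    \<comment> \<open>\<open>Bargmann1_add\<close> concerns Borel functions, so the sum is first
      moved to the sum of the representatives.\<close>
    have "G_transform \<nu> (\<lambda>x. f x + f' x) = G_transform \<nu> (\<lambda>x. g x + g' x)"
    proof (rule G_cong)
      show "(\<lambda>x. f x + f' x) \<in> borel_measurable lebesgue"
        using meas[OF f] meas[OF f'] by (rule borel_measurable_add)
      show "(\<lambda>x. g x + g' x) \<in> borel_measurable lebesgue"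
        using g(1) g'(1) by (intro measurable_completion) simp
      show "AE x in lebesgue. f x + f' x = g x + g' x"
        using g(2) g'(2) by eventually_elim simp
    qed
    then show "G_transform \<nu> (\<lambda>x. f x + f' x) = (\<lambda>z. G_transform \<nu> f z + G_transform \<nu> f' z)"
      unfolding Gfg Gfg' unfolding G_transform_def[abs_def]
      by (simp only: Bargmann1_add[OF g(1) g'(1) g(3) g'(3) assms] distrib_left)
  qed
qed

end
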